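(* Let $\varphi:\mathbb{D}\to\mathbb{D}$ be analytic and not constant, let $S_\varphi$ be the Schwarzian derivative of $\varphi$, and let $z_0\in\mathbb{D}$ be a critical point of $|D_\varphi(z)|$ with $\varphi'(z_0)\neq 0$. (i) If $|D_\varphi(z)|$ has a local maximum at $z_0$, then $$(1-|z_0|^2)^2|S_\varphi(z_0)|\leq 2\big(1-|D_\varphi(z_0)|^2\big).$$ (ii) If $(1-|z_0|^2)^2|S_\varphi(z_0)|< 2\big(1-|D_\varphi(z_0)|^2\big)$, then $|D_\varphi(z)|$ has a strict local maximum at $z_0$; in particular, $z_0$ is an isolated critical point. (iii) If $(1-|z_0|^2)^2|S_\varphi(z_0)|> 2\big(1-|D_\varphi(z_0)|^2\big)$, then $z_0$ is an isolated critical point and there exists a neighborhood $U_0$ of $z_0$ such that $U_0\cap C_\varphi(t_0)$ consists of two arcs that intersect at $z_0$ under a positive angle, where $t_0=|D_\varphi(z_0)|$.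
   Context: $\mathbb{D}$ is the open unit disk in $\mathbb{C}$. For $\varphi:\mathbb{D}\to\mathbb{D}$ analytic and non-constant, define $$D_\varphi(z)=\frac{(1-|z|^2)\varphi'(z)}{1-|\varphi(z)|^2},\qquad A_\varphi(z)=\frac{1-|z|^2}{2}\frac{\varphi''(z)}{\varphi'(z)}-\bar z+\frac{(1-|z|^2)\overline{\varphi(z)}\varphi'(z)}{1-|\varphi(z)|^2},$$ with $A_\varphi(z)=\infty$ at the zeros of $\varphi'$. One has $A_\varphi(z)=(1-|z|^2)\frac{\partial}{\partial z}\log|D_\varphi(z)|$ where $\varphi'(z)\neq0$. The critical points of $|D_\varphi|$ are the zeros of $\varphi'$ together with the zeros of $A_\varphi$. The level sets are $C_\varphi(t)=\{z\in\mathbb{D}:|D_\varphi(z)|=t\}$. The Schwarzian derivative is $S_\varphi=\left(\frac{\varphi''}{\varphi'}\right)'-\frac12\left(\frac{\varphi''}{\varphi'}\right)^2$. *)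

theory Defs
  imports "HOL-Complex_Analysis.Complex_Analysis"
begin

definition hyperbolic_derivative :: "(complex \<Rightarrow> complex) \<Rightarrow> complex \<Rightarrow> complex" where
  "hyperbolic_derivative \<phi> z =
     of_real (1 - (norm z)\<^sup>2) * deriv \<phi> z / of_real (1 - (norm (\<phi> z))\<^sup>2)"

text \<open>The function \<open>A\<close> takes values in the extended plane; \<^const>\<open>None\<close> stands for the value
  \<open>\<infinity>\<close> that it has at the zeros of the derivative.\<close>

definition A_function :: "(complex \<Rightarrow> complex) \<Rightarrow> complex \<Rightarrow> complex option" where
  "A_function \<phi> z =
     (if deriv \<phi> z = 0 then None
      else Some (of_real (1 - (norm z)\<^sup>2) / 2 * (deriv (deriv \<phi>) z / deriv \<phi> z) - cnj z
             + of_real (1 - (norm z)\<^sup>2) * cnj (\<phi> z) * deriv \<phi> z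
                 / of_real (1 - (norm (\<phi> z))\<^sup>2)))"

text \<open>Critical points of the modulus of the hyperbolic derivative. The modulus need not be
  differentiable at a zero of the derivative of \<open>\<phi>\<close>; such points count as critical.\<close>

definition critical_points :: "(complex \<Rightarrow> complex) \<Rightarrow> complex set" where
  "critical_points \<phi> = {z \<in> ball 0 1. deriv \<phi> z = 0 \<or> A_function \<phi> z = Some 0}"

definition level_curve :: "(complex \<Rightarrow> complex) \<Rightarrow> real \<Rightarrow> complex set" where
  "level_curve \<phi> t = {z \<in> ball 0 1. norm (hyperbolic_derivative \<phi> z) = t}"

definition schwarzian :: "(complex \<Rightarrow> complex) \<Rightarrow> complex \<Rightarrow> complex" where
  "schwarzian \<phi> z =
     deriv (\<lambda>w. deriv (deriv \<phi>) w / deriv \<phi> w) z - 1 / 2 * (deriv (deriv \<phi>) z / deriv \<phi> z)\<^sup>2"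

definition local_max_at :: "('a::topological_space \<Rightarrow> real) \<Rightarrow> 'a \<Rightarrow> bool" where
  "local_max_at f x \<longleftrightarrow> (\<forall>\<^sub>F y in nhds x. f y \<le> f x)"

definition strict_local_max_at :: "('a::topological_space \<Rightarrow> real) \<Rightarrow> 'a \<Rightarrow> bool" where
  "strict_local_max_at f x \<longleftrightarrow> (\<forall>\<^sub>F y in at x. f y < f x)"

text \<open>The unoriented angle, in the interval from \<open>0\<close> to \<open>\<pi>/2\<close>, between the real lines spanned by
  two non-zero vectors; it vanishes iff the lines coincide.\<close>

definition line_angle :: "complex \<Rightarrow> complex \<Rightarrow> real" where
  "line_angle v w = arccos (\<bar>v \<bullet> w\<bar> / (norm v * norm w))"

text \<open>Two parametrised arcs pass through \<open>p\<close> at interior parameters, have tangents there, and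
  these tangents form the angle \<open>\<theta>\<close>.\<close>

definition cross_at_angle ::
    "(real \<Rightarrow> complex) \<Rightarrow> (real \<Rightarrow> complex) \<Rightarrow> complex \<Rightarrow> real \<Rightarrow> bool" where
  "cross_at_angle g h p \<theta> \<longleftrightarrow>
     (\<exists>s\<in>{0<..<1}. \<exists>t\<in>{0<..<1}. \<exists>v w.
        g s = p \<and> (g has_vector_derivative v) (at s) \<and> v \<noteq> 0 \<and>
        h t = p \<and> (h has_vector_derivative w) (at t) \<and> w \<noteq> 0 \<and>
        \<theta> = line_angle v w)"

end

theory Submission
  imports Defs
begin

text \<open>
  Let \<open>u = ln \<bar>D\<bar>\<close>, where \<open>D\<close> is the hyperbolic derivative of \<open>\<phi>\<close>. Away from the zeros of
  \<open>\<phi>'\<close> it is the sum of \<open>ln (1 - \<bar>z\<bar>\<^sup>2)\<close>, \<open>- ln (1 - \<bar>\<phi>\<bar>\<^sup>2)\<close> and \<open>ln \<bar>\<phi>'\<bar>\<close>, so it is smooth and its Wirtinger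
  derivatives are explicit. The function \<open>A\<close> is \<open>1 - \<bar>z\<bar>\<^sup>2\<close> times \<open>u\<^sub>z\<close>, so the critical points there
  are the zeros of \<open>u\<^sub>z\<close>. At such a zero the mixed terms of \<open>u\<^sub>z\<^sub>z\<close> can be eliminated, and
  \<open>u\<^sub>z\<^sub>z\<close> becomes half the Schwarzian (\<open>log_grad_z_critical\<close>); the derivative of \<open>u\<^sub>z\<close> in \<open>cnj z\<close> is
  \<open>- (1 - \<bar>D\<bar>\<^sup>2) / (1 - \<bar>z\<bar>\<^sup>2)\<^sup>2\<close> everywhere (\<open>log_grad_zbar_eq\<close>). With \<open>a\<close> and \<open>b\<close> for these two second
  derivatives at the critical point \<open>z0\<close>, \<open>u (z0 + h) = u z0 + Re (a h\<^sup>2) + b \<bar>h\<bar>\<^sup>2 + o(\<bar>h\<bar>\<^sup>2)\<close>.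

  The quadratic form \<open>Re (a h\<^sup>2) + b \<bar>h\<bar>\<^sup>2\<close> has the eigenvalues \<open>b + \<bar>a\<bar>\<close> and \<open>b - \<bar>a\<bar>\<close>, and the three
  comparisons between \<open>(1 - \<bar>z0\<bar>\<^sup>2)\<^sup>2 \<bar>S\<bar>\<close> and \<open>2 (1 - \<bar>D\<bar>\<^sup>2)\<close> are the three signs of \<open>\<bar>a\<bar> + b\<close>. At a
  maximum the larger eigenvalue cannot be positive; if it is negative, the maximum is strict. If it is
  non-zero, then \<open>\<bar>a\<bar> \<noteq> \<bar>b\<bar>\<close> because \<open>b \<le> 0\<close> by the Schwarz-Pick lemma, so the linear map
  \<open>h \<mapsto> a h + b (cnj h)\<close> that approximates \<open>u\<^sub>z\<close> is injective, and the critical point is isolated.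

  If \<open>\<bar>a\<bar> + b > 0\<close>, then \<open>b \<le> 0\<close> makes \<open>z0\<close> a non-degenerate saddle, and the level set
  there can be described by elementary means (\<open>saddle_level_set_two_arcs\<close>). Rotate so that \<open>a > 0\<close>.
  In a small rectangle around \<open>z0\<close>, \<open>u - u z0\<close> is concave on vertical lines; on every vertical line but the central one it is
  positive on the real axis and negative at both ends, hence has exactly one zero above and one below
  the axis. The zeros with \<open>x y \<ge> 0\<close> form the graph of one function, those with \<open>x y \<le> 0\<close> the graph of
  another. Both graphs are closed, so the functions are continuous, and the expansion
  of \<open>u\<close> gives them the opposite non-zero slopes \<open>\<plusminus> sqrt ((a + b) / (a - b))\<close> at the
  centre. These graphs are the two arcs.
\<close>

section \<open>Zero sets of functions concave in one direction\<close>

text \<open>A second zero \<open>v\<close> beyond a zero \<open>u\<close> is impossible: \<open>u\<close> is a convex combination of \<open>0\<close> and \<open>v\<close>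
  with a positive weight on \<open>0\<close>, and concavity forces a positive value there.\<close>

lemma concave_sign_change_unique_zero:
  fixes G :: "real \<Rightarrow> real"
  assumes "0 \<le> R" and cont: "continuous_on {0..R} G" and conc: "concave_on {0..R} G"
    and pos: "0 < G 0" and neg: "G R < 0"
  shows "\<exists>!u. u \<in> {0..R} \<and> G u = 0"
proof (rule ex_ex1I)
  show "\<exists>u. u \<in> {0..R} \<and> G u = 0"
    using IVT2'[of G R 0 0] assms by force
next
  have less: False if "0 \<le> u" "u < v" "v \<le> R" "G u = 0" "G v = 0" for u v
  proof -
    have "0 < v" using that by simp
    have "(1 - u/v) * G 0 + (u/v) * G v \<le> G ((1 - u/v) *\<^sub>R 0 + (u/v) *\<^sub>R v)"
      using conc that \<open>0 < v\<close> by (intro concave_onD) auto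
    moreover have "(1 - u/v) *\<^sub>R 0 + (u/v) *\<^sub>R v = u" using \<open>0 < v\<close> by simp
    moreover have "(1 - u/v) * G 0 > 0" using pos that \<open>0 < v\<close> by simp
    ultimately show False using that by simp
  qed
  show "u = v" if "u \<in> {0..R} \<and> G u = 0" "v \<in> {0..R} \<and> G v = 0" for u v
    using less[of u v] less[of v u] that by (meson atLeastAtMost_iff linorder_neqE_linordered_idom)
qed

text \<open>For \<open>x \<noteq> 0\<close> the condition \<open>0 \<le> x * y\<close> selects one of the two vertical half-lines, on which the
  preceding lemma gives a single zero; for \<open>x = 0\<close> it is vacuous, but on the central line only the centre is a zero. The graph of the resulting function is a closed set and the function is bounded, so it is
  continuous. The second branch, \<open>x * y \<le> 0\<close>, is this one for \<open>Q \<circ> cnj\<close>.\<close>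

lemma concave_zero_branch:
  fixes Q :: "complex \<Rightarrow> real"
  assumes "0 < r" "0 < R"
    and cont: "continuous_on {z. \<bar>Re z\<bar> \<le> r \<and> \<bar>Im z\<bar> \<le> R} Q"
    and conc: "\<And>x. \<bar>x\<bar> \<le> r \<Longrightarrow> concave_on {-R..R} (\<lambda>y. Q (Complex x y))"
    and pos: "\<And>x. \<bar>x\<bar> \<le> r \<Longrightarrow> x \<noteq> 0 \<Longrightarrow> Q (Complex x 0) > 0"
    and neg: "\<And>x y. \<bar>x\<bar> \<le> r \<Longrightarrow> \<bar>y\<bar> = R \<Longrightarrow> Q (Complex x y) < 0"
    and zero: "Q 0 = 0" and axis: "\<And>y. \<bar>y\<bar> \<le> R \<Longrightarrow> y \<noteq> 0 \<Longrightarrow> Q (Complex 0 y) < 0"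
  shows "\<exists>k. continuous_on {-r..r} k \<and>
    (\<forall>x y. \<bar>x\<bar> \<le> r \<longrightarrow> (\<bar>y\<bar> \<le> R \<and> Q (Complex x y) = 0 \<and> 0 \<le> x * y \<longleftrightarrow> y = k x))"
proof -
  have ex1: "\<exists>!y. \<bar>y\<bar> \<le> R \<and> Q (Complex x y) = 0 \<and> 0 \<le> x * y" if x: "\<bar>x\<bar> \<le> r" for x
  proof (cases "x = 0")
    case True
    have "Q (Complex 0 0) = 0" using zero by (simp add: Complex_eq)
    then show ?thesis using True axis \<open>0 < R\<close>
      by (intro ex1I[of _ 0]) force+
  next
    case False
    define s where "s = sgn x"
    have s: "\<bar>s\<bar> = 1" "s * s = 1" "x = s * \<bar>x\<bar>" using False by (auto simp: s_def sgn_if)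
    have "\<exists>!u. u \<in> {0..R} \<and> Q (Complex x (s * u)) = 0"
    proof (rule concave_sign_change_unique_zero)
      show "continuous_on {0..R} (\<lambda>u. Q (Complex x (s * u)))"
        using x s by (intro continuous_on_compose2[OF cont] continuous_intros) (auto simp: abs_mult)
      show "concave_on {0..R} (\<lambda>u. Q (Complex x (s * u)))"
        unfolding concave_on_iff
      proof (intro conjI ballI allI impI)
        fix u v a b :: real assume *: "u \<in> {0..R}" "v \<in> {0..R}" "0 \<le> a" "0 \<le> b" "a + b = 1"
        have "s * u \<in> {-R..R}" "s * v \<in> {-R..R}"
          using * s(1) abs_le_iff[of "s * u" R] abs_le_iff[of "s * v" R] by (auto simp: abs_mult)
        then have "a * Q (Complex x (s * u)) + b * Q (Complex x (s * v))
             \<le> Q (Complex x (a *\<^sub>R (s * u) + b *\<^sub>R (s * v)))"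
          using conc[OF x] * unfolding concave_on_iff by blast
        then show "a * Q (Complex x (s * u)) + b * Q (Complex x (s * v))
             \<le> Q (Complex x (s * (a *\<^sub>R u + b *\<^sub>R v)))"
          by (simp add: algebra_simps)
      qed simp
      show "0 < Q (Complex x (s * 0))" using pos x False by simp
      show "Q (Complex x (s * R)) < 0" using neg[OF x, of "s*R"] s \<open>0 < R\<close> by (simp add: abs_mult)
    qed (use \<open>0 < R\<close> in simp)
    then obtain u where u: "u \<in> {0..R}" "Q (Complex x (s * u)) = 0"
      and uu: "\<And>v. v \<in> {0..R} \<Longrightarrow> Q (Complex x (s * v)) = 0 \<Longrightarrow> v = u" by auto
    show ?thesis
    proof (rule ex1I[of _ "s * u"])
      have "x * (s * u) = \<bar>x\<bar> * u" using s by (metis mult.assoc mult.commute mult_1)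
      then have "0 \<le> x * (s * u)" using u(1) by (simp only: mult_nonneg_nonneg abs_ge_zero atLeastAtMost_iff)
      then show "\<bar>s * u\<bar> \<le> R \<and> Q (Complex x (s * u)) = 0 \<and> 0 \<le> x * (s * u)"
        using u s(1) by (simp add: abs_mult)
      fix y assume y: "\<bar>y\<bar> \<le> R \<and> Q (Complex x y) = 0 \<and> 0 \<le> x * y"
      have "0 \<le> s * y" using y False by (auto simp: s_def sgn_if zero_le_mult_iff)
      then have "s * y \<in> {0..R}" using y s abs_le_iff[of "s*y" R] by (auto simp: abs_mult)
      moreover have "s * (s * y) = y" using s by (metis mult.assoc mult_1)
      ultimately show "y = s * u" using uu[of "s * y"] y by metis
    qed
  qed
  define k where "k x = (THE y. \<bar>y\<bar> \<le> R \<and> Q (Complex x y) = 0 \<and> 0 \<le> x * y)" for x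
  have k: "\<bar>y\<bar> \<le> R \<and> Q (Complex x y) = 0 \<and> 0 \<le> x * y \<longleftrightarrow> y = k x" if "\<bar>x\<bar> \<le> r" for x y
    using ex1[OF that] theI'[OF ex1[OF that]] unfolding k_def by blast
  \<comment> \<open>Membership in the graph is a closed condition on \<open>(x, y)\<close>.\<close>
  have graph: "(\<lambda>x. (x, k x)) ` {-r..r} =
      ({-r..r} \<times> {-R..R}) \<inter> (\<lambda>(x,y). Q (Complex x y)) -` {0} \<inter> {p. 0 \<le> fst p * snd p}"
    (is "_ = ?Z")
  proof (rule set_eqI)
    fix p :: "real \<times> real"
    obtain x y where p: "p = (x, y)" by (cases p)
    have "p \<in> ?Z \<longleftrightarrow> \<bar>x\<bar> \<le> r \<and> \<bar>y\<bar> \<le> R \<and> Q (Complex x y) = 0 \<and> 0 \<le> x * y"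
      by (auto simp: p abs_le_iff)
    also have "\<dots> \<longleftrightarrow> \<bar>x\<bar> \<le> r \<and> y = k x" using k by blast
    finally show "p \<in> (\<lambda>x. (x, k x)) ` {-r..r} \<longleftrightarrow> p \<in> ?Z" by (auto simp: p abs_le_iff)
  qed
  have "continuous_on {-r..r} k"
  proof (rule continuous_from_closed_graph)
    show "k \<in> {-r..r} \<rightarrow> {-R..R}"
    proof
      fix x assume "x \<in> {-r..r}"
      then have "\<bar>x\<bar> \<le> r" by auto
      then have "\<bar>k x\<bar> \<le> R" using k[of x "k x"] by simp
      then show "k x \<in> {-R..R}" by (auto simp: abs_le_iff)
    qed
    have "continuous_on ({-r..r} \<times> {-R..R}) (\<lambda>(x,y). Q (Complex x y))"
      unfolding case_prod_unfold
      by (intro continuous_on_compose2[OF cont] continuous_intros) auto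
    then have "closed (({-r..r} \<times> {-R..R}) \<inter> (\<lambda>(x,y). Q (Complex x y)) -` {0})"
      by (intro continuous_closed_preimage closed_Times) auto
    moreover have "closed {p::real\<times>real. 0 \<le> fst p * snd p}"
      by (intro closed_Collect_le continuous_intros)
    ultimately show "closed ((\<lambda>x. (x, k x)) ` {-r..r})"
      unfolding graph by (rule closed_Int)
  qed simp
  then show ?thesis using k by blast
qed

text \<open>If \<open>E\<close> is the relative error of the expansion of \<open>Q\<close>, then along the zero branch
  \<open>(k x / x)\<^sup>2 = (\<alpha> + E) / (\<beta> - E)\<close>, and the sign condition selects the positive root.\<close>

lemma zero_branch_slope:
  fixes Q :: "complex \<Rightarrow> real" and k :: "real \<Rightarrow> real"
  assumes "0 < \<alpha>" "0 < \<beta>"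
    and taylor: "((\<lambda>h. (Q h - (\<alpha> * (Re h)\<^sup>2 - \<beta> * (Im h)\<^sup>2)) / (norm h)\<^sup>2) \<longlongrightarrow> 0) (at 0)"
    and k0: "k 0 = 0" and kc: "isCont k 0"
    and ev: "\<forall>\<^sub>F x in at 0. Q (Complex x (k x)) = 0 \<and> 0 \<le> x * k x"
  shows "(k has_real_derivative sqrt (\<alpha> / \<beta>)) (at 0)"
proof -
  define E where "E h = (Q h - (\<alpha> * (Re h)\<^sup>2 - \<beta> * (Im h)\<^sup>2)) / (norm h)\<^sup>2" for h
  have kt: "(k \<longlongrightarrow> 0) (at 0)" using kc k0 by (simp add: isCont_def)
  have "((\<lambda>x. Complex x (k x)) \<longlongrightarrow> Complex 0 0) (at 0)"
    by (intro tendsto_intros kt)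
  moreover have "\<forall>\<^sub>F x in at 0. Complex x (k x) \<noteq> 0"
    using eventually_neq_at_within[of 0] by eventually_elim (simp add: Complex_eq_0)
  ultimately have "filterlim (\<lambda>x. Complex x (k x)) (at 0) (at 0)"
    by (simp add: filterlim_at zero_complex.code)
  then have El: "((\<lambda>x. E (Complex x (k x))) \<longlongrightarrow> 0) (at 0)"
    using taylor unfolding E_def[symmetric] by (rule filterlim_compose[rotated])
  have "((\<lambda>x. (\<alpha> + E (Complex x (k x))) / (\<beta> - E (Complex x (k x)))) \<longlongrightarrow> (\<alpha> + 0) / (\<beta> - 0)) (at 0)"
    using \<open>0 < \<beta>\<close> by (intro tendsto_intros El) auto
  then have lim: "((\<lambda>x. sqrt ((\<alpha> + E (Complex x (k x))) / (\<beta> - E (Complex x (k x))))) \<longlongrightarrow> sqrt (\<alpha> / \<beta>)) (at 0)"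
    by (intro tendsto_real_sqrt) simp
  have Es: "\<forall>\<^sub>F x in at 0. E (Complex x (k x)) < \<beta>"
    using order_tendstoD(2)[OF El \<open>0 < \<beta>\<close>] .
  have "\<forall>\<^sub>F x in at 0. sqrt ((\<alpha> + E (Complex x (k x))) / (\<beta> - E (Complex x (k x)))) = k x / x"
    using ev Es eventually_neq_at_within[of 0]
  proof eventually_elim
    case (elim x)
    define e where "e = E (Complex x (k x))"
    have n: "(norm (Complex x (k x)))\<^sup>2 = x\<^sup>2 + (k x)\<^sup>2" by (simp add: cmod_power2)
    have "x\<^sup>2 + (k x)\<^sup>2 > 0" using elim by (simp add: sum_power2_gt_zero_iff)
    then have "e * (x\<^sup>2 + (k x)\<^sup>2) = - (\<alpha> * x\<^sup>2 - \<beta> * (k x)\<^sup>2)"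
      using elim by (simp add: e_def E_def n)
    then have "(\<alpha> + e) * x\<^sup>2 = (\<beta> - e) * (k x)\<^sup>2" by (simp add: algebra_simps)
    then have "(\<alpha> + e) / (\<beta> - e) = (k x / x)\<^sup>2"
      using elim by (simp add: e_def power_divide field_simps)
    moreover have "0 \<le> k x / x" using elim by (auto simp: zero_le_mult_iff zero_le_divide_iff)
    ultimately show ?case using real_sqrt_unique[of "k x / x"] by (simp add: e_def)
  qed
  then have "((\<lambda>x. k x / x) \<longlongrightarrow> sqrt (\<alpha> / \<beta>)) (at 0)"
    using lim by (rule Lim_transform_eventually[rotated])
  then show ?thesis by (simp add: has_field_derivative_iff k0)
qed

section \<open>Critical points in terms of Wirtinger derivatives\<close>

abbreviation second_order_expansion :: "(complex \<Rightarrow> real) \<Rightarrow> complex \<Rightarrow> complex \<Rightarrow> real \<Rightarrow> bool" where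
  "second_order_expansion f z0 a b \<equiv>
     ((\<lambda>h. (f (z0 + h) - f z0 - (Re (a * h\<^sup>2) + b * (norm h)\<^sup>2)) / (norm h)\<^sup>2) \<longlongrightarrow> 0) (at 0)"

text \<open>The hypotheses say that \<open>p\<close> is the Wirtinger derivative of the real function \<open>f\<close> in \<open>z\<close>, and
  that \<open>a\<close> and \<open>b\<close> are the derivatives of \<open>p\<close> in \<open>z\<close> and in \<open>cnj z\<close> at \<open>z0\<close>. The mean value theorem on the
  segment from \<open>z0\<close> to \<open>z0 + h\<close>, applied to the difference of \<open>f\<close> and the quadratic form, bounds this
  difference by \<open>2 \<bar>h\<bar>\<close> times the error of the linear approximation to \<open>p\<close>.\<close>

lemma second_order_expansion_at_critical_point:
  fixes f :: "complex \<Rightarrow> real" and p :: "complex \<Rightarrow> complex"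
  assumes S: "open S" "z0 \<in> S"
    and df: "\<And>z. z \<in> S \<Longrightarrow> (f has_derivative (\<lambda>h. 2 * Re (p z * h))) (at z)"
    and p0: "p z0 = 0"
    and dp: "(p has_derivative (\<lambda>h. a * h + of_real b * cnj h)) (at z0)"
  shows "second_order_expansion f z0 a b"
proof -
  have nn: "Re (cnj h * h) = (norm h)\<^sup>2" for h
    using cmod_power2[of h] by (simp add: power2_eq_square)
  have bound: "\<exists>d>0. \<forall>h. norm h < d \<longrightarrow>
      \<bar>f (z0 + h) - f z0 - (Re (a * h\<^sup>2) + b * (norm h)\<^sup>2)\<bar> \<le> 2 * e * (norm h)\<^sup>2" if "0 < e" for e
  proof -
    obtain d0 where d0: "0 < d0" "ball z0 d0 \<subseteq> S" using S openE by blast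
    obtain d1 where d1: "0 < d1"
      "\<And>y. norm (y - z0) < d1 \<Longrightarrow> norm (p y - p z0 - (a * (y - z0) + of_real b * cnj (y - z0))) \<le> e * norm (y - z0)"
      using conjunct2[OF dp[unfolded has_derivative_at_alt], rule_format, OF \<open>0 < e\<close>] by blast
    have "\<bar>f (z0 + h) - f z0 - (Re (a * h\<^sup>2) + b * (norm h)\<^sup>2)\<bar> \<le> 2 * e * (norm h)\<^sup>2"
      if h: "norm h < min d0 d1" for h
    proof -
      \<comment> \<open>\<open>t\<^sup>2\<close> times the quadratic form at \<open>h\<close> is its value at \<open>t h\<close>, the point reached at time \<open>t\<close>.\<close>
      define G where "G t = f (z0 + of_real t * h) - t\<^sup>2 * (Re (a * h\<^sup>2) + b * (norm h)\<^sup>2)" for t :: real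
      define G' where "G' t = 2 * Re (p (z0 + of_real t * h) * h) - 2 * t * (Re (a * h\<^sup>2) + b * (norm h)\<^sup>2)" for t :: real
      have tn: "norm (of_real t * h) \<le> norm h" if "t \<in> {0..1}" for t :: real
        using that by (simp add: norm_mult mult_left_le_one_le)
      have der: "(G has_real_derivative G' t) (at t)" if "t \<in> {0..1}" for t
      proof -
        have "z0 + of_real t * h \<in> S"
          using tn[OF that] h d0 by (auto simp: dist_norm)
        from df[OF this] have "((\<lambda>t. f (z0 + of_real t * h)) has_derivative (\<lambda>s. 2 * Re (p (z0 + of_real t * h) * (of_real s * h)))) (at t)"
          by (rule has_derivative_compose[rotated]) (auto intro!: derivative_eq_intros)
        then have "((\<lambda>t. f (z0 + of_real t * h)) has_real_derivative 2 * Re (p (z0 + of_real t * h) * h)) (at t)"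
          unfolding has_field_derivative_def
          by (rule has_derivative_eq_rhs) (auto simp: fun_eq_iff algebra_simps)
        then show ?thesis
          unfolding G_def G'_def by (auto intro!: derivative_eq_intros)
      qed
      have "\<exists>t. t > 0 \<and> t < 1 \<and> G 1 - G 0 = (1 - 0) * G' t"
        using der by (intro MVT2) auto
      then obtain t where t: "0 < t" "t < 1" "G 1 - G 0 = G' t" by auto
      define y where "y = z0 + of_real t * h"
      have y: "y - z0 = of_real t * h" by (simp add: y_def)
      define \<rho> where "\<rho> = p y - (a * (y - z0) + of_real b * cnj (y - z0))"
      have "norm (y - z0) < d1" using tn[of t] t h by (simp add: y)
      then have "norm \<rho> \<le> e * norm (y - z0)" using d1(2)[of y] by (simp add: \<rho>_def p0)
      also have "\<dots> \<le> e * norm h" using tn[of t] t \<open>0 < e\<close> by (simp add: y)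
      finally have \<rho>: "norm \<rho> \<le> e * norm h" .
      have "G' t = 2 * Re (\<rho> * h)"
      proof -
        have py: "p y = \<rho> + (a * (of_real t * h) + of_real b * (of_real t * cnj h))"
          by (simp add: \<rho>_def y)
        have "Re (p y * h) = Re (\<rho> * h) + t * (Re (a * h\<^sup>2) + b * Re (cnj h * h))"
          unfolding py by (simp add: algebra_simps power2_eq_square)
        then show ?thesis unfolding G'_def y_def[symmetric] nn by (simp add: algebra_simps)
      qed
      also have "\<bar>\<dots>\<bar> \<le> 2 * (norm \<rho> * norm h)"
        using abs_Re_le_cmod[of "\<rho> * h"] by (simp add: norm_mult abs_mult)
      also have "\<dots> \<le> 2 * (e * norm h * norm h)"
        using \<rho> by (intro mult_left_mono mult_right_mono) auto
      finally have "\<bar>G 1 - G 0\<bar> \<le> 2 * e * (norm h)\<^sup>2" using t by (simp add: power2_eq_square mult.assoc)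
      then show ?thesis by (simp add: G_def algebra_simps)
    qed
    then show ?thesis using d0(1) d1(1) by (intro exI[of _ "min d0 d1"]) auto
  qed
  show ?thesis
  proof (rule tendstoI)
    fix e :: real assume "0 < e"
    then obtain d where d: "d > 0" "\<And>h. norm h < d \<Longrightarrow>
      \<bar>f (z0 + h) - f z0 - (Re (a * h\<^sup>2) + b * (norm h)\<^sup>2)\<bar> \<le> 2 * (e/4) * (norm h)\<^sup>2"
      using bound[of "e/4"] by auto
    have "\<forall>h. h \<noteq> 0 \<and> dist h 0 < d \<longrightarrow>
       dist ((f (z0 + h) - f z0 - (Re (a * h\<^sup>2) + b * (norm h)\<^sup>2)) / (norm h)\<^sup>2) 0 < e"
    proof (intro allI impI)
      fix h :: complex assume h: "h \<noteq> 0 \<and> dist h 0 < d"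
      then have pos: "(norm h)\<^sup>2 > 0" by simp
      have "\<bar>f (z0 + h) - f z0 - (Re (a * h\<^sup>2) + b * (norm h)\<^sup>2)\<bar> \<le> 2 * (e/4) * (norm h)\<^sup>2"
        using d(2) h by simp
      also have "\<dots> < e * (norm h)\<^sup>2" using pos \<open>0 < e\<close> by simp
      finally show "dist ((f (z0 + h) - f z0 - (Re (a * h\<^sup>2) + b * (norm h)\<^sup>2)) / (norm h)\<^sup>2) 0 < e"
        using pos by (simp add: divide_less_eq)
    qed
    then show "\<forall>\<^sub>F h in at 0. dist ((f (z0 + h) - f z0 - (Re (a * h\<^sup>2) + b * (norm h)\<^sup>2)) / (norm h)\<^sup>2) 0 < e"
      unfolding eventually_at using \<open>d > 0\<close> by auto
  qed
qed

text \<open>The real-linear map \<open>h \<mapsto> a h + b (cnj h)\<close> stretches every \<open>h\<close> by at least \<open>\<bar>\<bar>a\<bar> - \<bar>b\<bar>\<bar>\<close>.\<close>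

lemma real_linear_derivative_isolated_zero:
  fixes p :: "complex \<Rightarrow> complex"
  assumes "p z0 = 0" and dp: "(p has_derivative (\<lambda>h. a * h + b * cnj h)) (at z0)"
    and ne: "norm a \<noteq> norm b"
  shows "\<forall>\<^sub>F z in at z0. p z \<noteq> 0"
proof -
  define e where "e = \<bar>norm a - norm b\<bar> / 2"
  have "e > 0" using ne by (simp add: e_def)
  then obtain d where d: "d > 0"
    "\<And>y. norm (y - z0) < d \<Longrightarrow> norm (p y - p z0 - (a * (y - z0) + b * cnj (y - z0))) \<le> e * norm (y - z0)"
    using dp unfolding has_derivative_at_alt by blast
  have "p z \<noteq> 0" if "z \<noteq> z0" "dist z z0 < d" for z
  proof
    assume "p z = 0"
    then have "norm (a * (z - z0) + b * cnj (z - z0)) \<le> e * norm (z - z0)"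
      using d(2)[of z] that assms(1) norm_minus_cancel[of "a * (z - z0) + b * cnj (z - z0)"]
      by (simp add: dist_norm del: norm_minus_cancel)
    moreover have "\<bar>norm (a * (z - z0)) - norm (b * cnj (z - z0))\<bar> \<le> norm (a * (z - z0) + b * cnj (z - z0))"
      by (metis norm_triangle_ineq3 norm_minus_cancel diff_minus_eq_add)
    moreover have "\<bar>norm (a * (z - z0)) - norm (b * cnj (z - z0))\<bar> = 2 * e * norm (z - z0)"
      by (simp only: norm_mult complex_mod_cnj e_def flip: left_diff_distrib) (simp add: abs_mult)
    moreover have "e * norm (z - z0) > 0" using that \<open>e > 0\<close> by simp
    ultimately show False by linarith
  qed
  then show ?thesis unfolding eventually_at using d(1) by (intro exI[of _ d]) auto
qed

text \<open>The largest value of \<open>Re (a h\<^sup>2) + b \<bar>h\<bar>\<^sup>2\<close> on the unit circle is \<open>\<bar>a\<bar> + b\<close>.\<close>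

lemma strict_max_if_neg:
  fixes f :: "complex \<Rightarrow> real"
  assumes taylor: "second_order_expansion f z0 a b"
    and neg: "norm a + b < 0"
  shows "\<forall>\<^sub>F z in at z0. f z < f z0"
proof -
  have "\<forall>\<^sub>F h in at 0. (f (z0 + h) - f z0 - (Re (a * h\<^sup>2) + b * (norm h)\<^sup>2)) / (norm h)\<^sup>2 < - (norm a + b)"
    using order_tendstoD(2)[OF taylor, of "- (norm a + b)"] neg by simp
  then have "\<forall>\<^sub>F h in at 0. f (z0 + h) < f z0"
    using eventually_neq_at_within[of 0]
  proof eventually_elim
    case (elim h)
    have "f (z0 + h) - f z0 - (Re (a * h\<^sup>2) + b * (norm h)\<^sup>2) < - (norm a + b) * (norm h)\<^sup>2"
      using elim by (simp add: divide_less_eq)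
    moreover have "Re (a * h\<^sup>2) \<le> norm a * (norm h)\<^sup>2"
      using complex_Re_le_cmod[of "a * h\<^sup>2"] by (simp add: norm_mult norm_power)
    ultimately show ?case by (simp add: algebra_simps)
  qed
  then show ?thesis
    by (subst at_to_0) (simp add: eventually_filtermap add.commute)
qed

lemma rotation_exists:
  fixes a :: complex obtains \<omega> where "norm \<omega> = 1" "\<omega>\<^sup>2 * a = of_real (norm a)"
proof
  define \<omega> where "\<omega> = cis (- (Arg a / 2))"
  show "norm \<omega> = 1" by (simp add: \<omega>_def)
  have "\<omega>\<^sup>2 = cis (- Arg a)" by (simp add: \<omega>_def power2_eq_square cis_mult)
  moreover have "a = of_real (norm a) * cis (Arg a)"
    by (metis rcis_cmod_Arg rcis_def)
  ultimately show "\<omega>\<^sup>2 * a = of_real (norm a)"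
    by (metis (no_types) add.left_inverse cis_mult cis_zero mult.left_commute mult_1_right)
qed

text \<open>In the direction \<open>\<omega>\<close> that makes \<open>a \<omega>\<^sup>2\<close> positive, the quadratic form grows at the rate \<open>\<bar>a\<bar> + b\<close>.\<close>

lemma local_max_imp_nonpos:
  fixes f :: "complex \<Rightarrow> real"
  assumes taylor: "second_order_expansion f z0 a b"
    and max: "\<forall>\<^sub>F z in nhds z0. f z \<le> f z0"
  shows "norm a + b \<le> 0"
proof (rule ccontr)
  assume pos: "\<not> norm a + b \<le> 0"
  obtain \<omega> where \<omega>: "norm \<omega> = 1" "\<omega>\<^sup>2 * a = of_real (norm a)" by (rule rotation_exists)
  have ev: "\<forall>\<^sub>F h in at 0. - (norm a + b) < (f (z0 + h) - f z0 - (Re (a * h\<^sup>2) + b * (norm h)\<^sup>2)) / (norm h)\<^sup>2"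
    using order_tendstoD(1)[OF taylor, of "- (norm a + b)"] pos by simp
  have "\<forall>\<^sub>F z in at z0. f z \<le> f z0"
    using max by (simp add: eventually_at_filter eventually_mono)
  then have mx: "\<forall>\<^sub>F h in at 0. f (z0 + h) \<le> f z0"
    by (subst (asm) at_to_0) (simp add: eventually_filtermap add.commute)
  have "((\<lambda>t. of_real t * \<omega>) \<longlongrightarrow> of_real 0 * \<omega>) (at_right (0::real))"
    by (intro tendsto_intros)
  moreover have "\<forall>\<^sub>F t in at_right (0::real). of_real t * \<omega> \<noteq> 0"
    using eventually_at_right_less[of 0] by eventually_elim (use \<omega> in auto)
  ultimately have "filterlim (\<lambda>t. of_real t * \<omega>) (at 0) (at_right (0::real))"
    by (simp add: filterlim_at)
  note ev0 = eventually_compose_filterlim[OF eventually_conj[OF ev mx] this]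
  have "\<exists>t. 0 < t \<and> - (norm a + b) < (f (z0 + of_real t * \<omega>) - f z0 - (Re (a * (of_real t * \<omega>)\<^sup>2)
      + b * (norm (of_real t * \<omega>))\<^sup>2)) / (norm (of_real t * \<omega>))\<^sup>2 \<and> f (z0 + of_real t * \<omega>) \<le> f z0"
    by (rule eventually_happens'[OF trivial_limit_at_right_real
        eventually_conj[OF eventually_at_right_less[of 0] ev0]])
  then obtain t where t: "0 < t" "f (z0 + of_real t * \<omega>) \<le> f z0" and
    l: "- (norm a + b) < (f (z0 + of_real t * \<omega>) - f z0 - (Re (a * (of_real t * \<omega>)\<^sup>2)
      + b * (norm (of_real t * \<omega>))\<^sup>2)) / (norm (of_real t * \<omega>))\<^sup>2" by auto
  have "a * (of_real t * \<omega>)\<^sup>2 = of_real (t\<^sup>2 * norm a)"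
    using \<omega>(2) by (simp add: power_mult_distrib mult.commute mult.left_commute)
  then have "Re (a * (of_real t * \<omega>)\<^sup>2) = t\<^sup>2 * norm a" by (metis Re_complex_of_real)
  moreover have "(norm (of_real t * \<omega>))\<^sup>2 = t\<^sup>2" using \<omega>(1) by (simp add: norm_mult)
  ultimately have "- (norm a + b) < (f (z0 + of_real t * \<omega>) - f z0 - (t\<^sup>2 * norm a + b * t\<^sup>2)) / t\<^sup>2"
    using l by simp
  then have "- (norm a + b) * t\<^sup>2 < f (z0 + of_real t * \<omega>) - f z0 - (t\<^sup>2 * norm a + b * t\<^sup>2)"
    using t by (simp add: less_divide_eq)
  then show False using t by (simp add: algebra_simps)
qed

section \<open>The level set through a saddle\<close>

text \<open>Here \<open>f\<close> is \<open>a (x\<^sup>2 - y\<^sup>2) + b (x\<^sup>2 + y\<^sup>2)\<close> up to higher order, with \<open>b = p2 0\<close>, and \<open>f\<^sub>y\<^sub>y = 2 (p2 - Re p1)\<close>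
  is negative near \<open>0\<close>. The half-height \<open>R\<close> of the rectangle comes first, and then
  the half-width \<open>r\<close> is taken so small that \<open>f\<close> stays negative on the two horizontal edges.\<close>

lemma saddle_normal_form:
  fixes f :: "complex \<Rightarrow> real" and p p1 :: "complex \<Rightarrow> complex" and p2 :: "complex \<Rightarrow> real"
  assumes S: "open S" "0 \<in> S"
    and df: "\<And>z. z \<in> S \<Longrightarrow> (f has_derivative (\<lambda>h. 2 * Re (p z * h))) (at z)"
    and dp: "\<And>z. z \<in> S \<Longrightarrow> (p has_derivative (\<lambda>h. p1 z * h + of_real (p2 z) * cnj h)) (at z)"
    and c1: "isCont p1 0" and c2: "isCont p2 0"
    and p0: "p 0 = 0" and f0: "f 0 = 0" and a: "p1 0 = of_real a" "\<bar>p2 0\<bar> < a"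
  obtains r R k l c where "0 < r" "0 < R" "0 < c"
    and "\<And>x y. \<bar>x\<bar> \<le> r \<Longrightarrow> \<bar>y\<bar> \<le> R \<Longrightarrow> Complex x y \<in> S"
    and "continuous_on {-r..r} k" "continuous_on {-r..r} l"
    and "\<And>x y. \<bar>x\<bar> \<le> r \<Longrightarrow> \<bar>y\<bar> \<le> R \<and> f (Complex x y) = 0 \<longleftrightarrow> y = k x \<or> y = l x"
    and "k 0 = 0" "l 0 = 0" "\<And>x. \<bar>x\<bar> \<le> r \<Longrightarrow> k x = l x \<Longrightarrow> x = 0"
    and "(k has_real_derivative c) (at 0)" "(l has_real_derivative - c) (at 0)"
proof -
  define \<alpha> \<beta> where "\<alpha> = a + p2 0" and "\<beta> = a - p2 0"
  have pos: "0 < \<alpha>" "0 < \<beta>" using a(2) by (auto simp: \<alpha>_def \<beta>_def)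
  define E where "E h = (f h - (\<alpha> * (Re h)\<^sup>2 - \<beta> * (Im h)\<^sup>2)) / (norm h)\<^sup>2" for h
  have form: "Re (p1 0 * h\<^sup>2) + p2 0 * (norm h)\<^sup>2 = \<alpha> * (Re h)\<^sup>2 - \<beta> * (Im h)\<^sup>2" for h
    unfolding cmod_power2 by (simp add: a(1) \<alpha>_def \<beta>_def algebra_simps power2_eq_square)
  have taylor: "(E \<longlongrightarrow> 0) (at 0)"
    using second_order_expansion_at_critical_point[OF S df p0 dp[OF S(2)], unfolded form] by (simp add: E_def[abs_def] f0)
  have "\<forall>\<^sub>F h in at 0. - \<alpha> < E h \<and> E h < \<beta>"
    using pos by (intro eventually_conj order_tendstoD[OF taylor]) auto
  then obtain d where d: "0 < d" "\<And>h. h \<noteq> 0 \<Longrightarrow> norm h < d \<Longrightarrow> - \<alpha> < E h \<and> E h < \<beta>"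
    unfolding eventually_at by auto
  have horizontal: "0 < f (Complex x 0)" if "x \<noteq> 0" "\<bar>x\<bar> < d" for x
  proof -
    have "- \<alpha> < E (Complex x 0)" using d(2)[of "Complex x 0"] that by (simp add: Complex_eq_0 cmod_def)
    then show ?thesis using that by (simp add: E_def cmod_power2 less_divide_eq algebra_simps)
  qed
  have vertical: "f (Complex 0 y) < 0" if "y \<noteq> 0" "\<bar>y\<bar> < d" for y
  proof -
    have "E (Complex 0 y) < \<beta>" using d(2)[of "Complex 0 y"] that by (simp add: Complex_eq_0 cmod_def)
    then show ?thesis using that by (simp add: E_def cmod_power2 divide_less_eq algebra_simps)
  qed
  have "((\<lambda>z. Re (p1 z) - p2 z) \<longlongrightarrow> Re (p1 0) - p2 0) (at 0)"
    by (intro tendsto_intros c1[unfolded isCont_def] c2[unfolded isCont_def])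
  then have "((\<lambda>z. Re (p1 z) - p2 z) \<longlongrightarrow> Re (p1 0) - p2 0) (nhds 0)"
    by (rule tendsto_at_iff_tendsto_nhds[THEN iffD1])
  moreover have "0 < Re (p1 0) - p2 0" using pos by (simp add: a \<beta>_def)
  ultimately have "\<forall>\<^sub>F z in nhds 0. 0 < Re (p1 z) - p2 z" by (rule order_tendstoD)
  moreover have "\<forall>\<^sub>F z in nhds 0. z \<in> S" using S by (rule eventually_nhds_in_open)
  ultimately have "\<forall>\<^sub>F z in nhds 0. 0 < Re (p1 z) - p2 z \<and> z \<in> S" by (rule eventually_conj)
  then obtain d' where d': "0 < d'" "\<And>z. norm z < d' \<Longrightarrow> p2 z < Re (p1 z) \<and> z \<in> S"
    unfolding eventually_nhds_metric by auto
  \<comment> \<open>The rectangle below has \<open>r \<le> R\<close>, so its points have norm at most \<open>2 R < d'\<close>.\<close>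
  define R where "R = min d d' / 3"
  have R: "0 < R" "R < d" "2 * R < d'" using d(1) d'(1) by (auto simp: R_def)
  have "\<exists>e>0. \<forall>x. \<bar>x\<bar> < e \<longrightarrow> f (Complex x y) < 0" if y: "\<bar>y\<bar> = R" for y
  proof -
    have "Complex 0 y \<in> S" using d'(2)[of "Complex 0 y"] y R by (simp add: cmod_def)
    then have "isCont f (Complex 0 y)" using df has_derivative_continuous by blast
    then have "\<forall>\<^sub>F z in nhds (Complex 0 y). f z < 0"
      using vertical[of y] y R
      by (intro order_tendstoD) (auto simp: continuous_at tendsto_at_iff_tendsto_nhds)
    then obtain e where e: "e > 0" "\<And>z. dist z (Complex 0 y) < e \<Longrightarrow> f z < 0"
      unfolding eventually_nhds_metric by auto
    have "dist (Complex x y) (Complex 0 y) = \<bar>x\<bar>" for x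
      by (simp add: dist_norm cmod_def)
    then show ?thesis using e by metis
  qed
  then obtain e1 e2 where e: "e1 > 0" "e2 > 0" "\<And>x. \<bar>x\<bar> < e1 \<Longrightarrow> f (Complex x R) < 0"
      "\<And>x. \<bar>x\<bar> < e2 \<Longrightarrow> f (Complex x (- R)) < 0"
    using R(1) by (metis abs_minus_cancel abs_of_pos)
  define r where "r = min R (min e1 e2 / 2)"
  have r: "0 < r" "r \<le> R" "r < e1" "r < e2" using e R by (auto simp: r_def)
  have rect: "norm (Complex x y) < d'" if "\<bar>x\<bar> \<le> r" "\<bar>y\<bar> \<le> R" for x y
    using cmod_le[of "Complex x y"] that r R by simp
  have rectS: "Complex x y \<in> S" if "\<bar>x\<bar> \<le> r" "\<bar>y\<bar> \<le> R" for x y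
    using d'(2) rect[OF that] by blast
  have contS: "continuous_on S f"
    using df has_derivative_continuous continuous_at_imp_continuous_on by blast
  have cont: "continuous_on {z. \<bar>Re z\<bar> \<le> r \<and> \<bar>Im z\<bar> \<le> R} f"
    by (rule continuous_on_subset[OF contS]) (use rectS in \<open>auto simp: complex_eq_iff\<close>, metis complex.collapse rectS)
  have conc: "concave_on {-R..R} (\<lambda>y. f (Complex x y))" if x: "\<bar>x\<bar> \<le> r" for x
  proof (rule f''_le0_imp_concave)
    fix y assume "y \<in> {-R..R}"
    then have y: "\<bar>y\<bar> \<le> R" by auto
    have dC: "((\<lambda>y. Complex x y) has_derivative (\<lambda>s. \<i> * of_real s)) (at y)"
      unfolding Complex_eq by (auto intro!: derivative_eq_intros)
    have "((\<lambda>y. f (Complex x y)) has_derivative (\<lambda>s. 2 * Re (p (Complex x y) * (\<i> * of_real s)))) (at y)"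
      by (rule has_derivative_compose[OF dC df[OF rectS[OF x y]]])
    then show "((\<lambda>y. f (Complex x y)) has_real_derivative - 2 * Im (p (Complex x y))) (at y)"
      unfolding has_field_derivative_def
      by (rule has_derivative_eq_rhs) (auto simp: fun_eq_iff)
    have "((\<lambda>y. p (Complex x y)) has_derivative (\<lambda>s. p1 (Complex x y) * (\<i> * of_real s) + of_real (p2 (Complex x y)) * cnj (\<i> * of_real s))) (at y)"
      by (rule has_derivative_compose[OF dC dp[OF rectS[OF x y]]])
    then have "((\<lambda>y. - 2 * Im (p (Complex x y))) has_derivative (\<lambda>s. - 2 * Im (p1 (Complex x y) * (\<i> * of_real s) + of_real (p2 (Complex x y)) * cnj (\<i> * of_real s)))) (at y)"
      by (intro has_derivative_mult_right has_derivative_Im)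
    then show "((\<lambda>y. - 2 * Im (p (Complex x y))) has_real_derivative 2 * (p2 (Complex x y) - Re (p1 (Complex x y)))) (at y)"
      unfolding has_field_derivative_def
      by (rule has_derivative_eq_rhs) (auto simp: fun_eq_iff algebra_simps)
    show "2 * (p2 (Complex x y) - Re (p1 (Complex x y))) \<le> 0"
      using d'(2)[OF rect[OF x y]] by simp
  qed simp
  have hor: "0 < f (Complex x 0)" if "\<bar>x\<bar> \<le> r" "x \<noteq> 0" for x
    using horizontal that r R by simp
  have ver: "f (Complex 0 y) < 0" if "\<bar>y\<bar> \<le> R" "y \<noteq> 0" for y
    using vertical that R by simp
  have edge: "f (Complex x y) < 0" if "\<bar>x\<bar> \<le> r" "\<bar>y\<bar> = R" for x y
    using e(3)[of x] e(4)[of x] that r by (auto simp: abs_if split: if_splits)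
  have "\<exists>k. continuous_on {-r..r} k \<and>
     (\<forall>x y. \<bar>x\<bar> \<le> r \<longrightarrow> (\<bar>y\<bar> \<le> R \<and> f (Complex x y) = 0 \<and> 0 \<le> x * y \<longleftrightarrow> y = k x))"
    by (rule concave_zero_branch[OF r(1) R(1) cont conc hor edge f0 ver])
  then obtain k where k: "continuous_on {-r..r} k"
     "\<And>x y. \<bar>x\<bar> \<le> r \<Longrightarrow> \<bar>y\<bar> \<le> R \<and> f (Complex x y) = 0 \<and> 0 \<le> x * y \<longleftrightarrow> y = k x"
    by blast
  have "\<exists>m. continuous_on {-r..r} m \<and>
     (\<forall>x y. \<bar>x\<bar> \<le> r \<longrightarrow> (\<bar>y\<bar> \<le> R \<and> (f \<circ> cnj) (Complex x y) = 0 \<and> 0 \<le> x * y \<longleftrightarrow> y = m x))"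
  proof (rule concave_zero_branch[OF r(1) R(1)])
    show "continuous_on {z. \<bar>Re z\<bar> \<le> r \<and> \<bar>Im z\<bar> \<le> R} (f \<circ> cnj)"
      unfolding o_def by (intro continuous_on_compose2[OF cont] continuous_intros) auto
    show "concave_on {-R..R} (\<lambda>y. (f \<circ> cnj) (Complex x y))" if "\<bar>x\<bar> \<le> r" for x
      unfolding concave_on_iff
    proof (intro conjI ballI allI impI)
      fix u v s t :: real
      assume *: "u \<in> {-R..R}" "v \<in> {-R..R}" "0 \<le> s" "0 \<le> t" "s + t = 1"
      then have "- u \<in> {-R..R}" "- v \<in> {-R..R}" by auto
      then have "s * f (Complex x (- u)) + t * f (Complex x (- v)) \<le> f (Complex x (s *\<^sub>R (- u) + t *\<^sub>R (- v)))"
        using conc[OF that] * unfolding concave_on_iff by blast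
      then show "s * (f \<circ> cnj) (Complex x u) + t * (f \<circ> cnj) (Complex x v)
          \<le> (f \<circ> cnj) (Complex x (s *\<^sub>R u + t *\<^sub>R v))"
        by (simp add: complex_cnj)
    qed simp
  qed (use hor edge f0 ver in \<open>auto simp: complex_cnj\<close>)
  then obtain m where m: "continuous_on {-r..r} m"
     "\<And>x y. \<bar>x\<bar> \<le> r \<Longrightarrow> \<bar>y\<bar> \<le> R \<and> (f \<circ> cnj) (Complex x y) = 0 \<and> 0 \<le> x * y \<longleftrightarrow> y = m x"
    by blast
  have k0: "k 0 = 0" and m0: "m 0 = 0"
    using k(2)[of 0 0] m(2)[of 0 0] r R f0 by (simp_all flip: zero_complex.code)
  have isC: "isCont k 0" "isCont m 0"
    using k(1) m(1) r(1) by (auto intro: continuous_on_interior)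
  have near: "\<forall>\<^sub>F x in at 0. \<bar>x\<bar> \<le> r"
    unfolding eventually_at using r(1) by (intro exI[of _ r]) auto
  have kd: "(k has_real_derivative sqrt (\<alpha> / \<beta>)) (at 0)"
  proof (rule zero_branch_slope[OF pos _ k0 isC(1), of f])
    show "\<forall>\<^sub>F x in at 0. f (Complex x (k x)) = 0 \<and> 0 \<le> x * k x"
      using near by eventually_elim (use k(2) in blast)
  qed (use taylor in \<open>simp add: E_def[abs_def]\<close>)
  have md: "(m has_real_derivative sqrt (\<alpha> / \<beta>)) (at 0)"
  proof (rule zero_branch_slope[OF pos _ m0 isC(2), of "f \<circ> cnj"])
    show "\<forall>\<^sub>F x in at 0. (f \<circ> cnj) (Complex x (m x)) = 0 \<and> 0 \<le> x * m x"
      using near by eventually_elim (use m(2) in auto)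
    have "filterlim cnj (at 0) (at 0)"
      unfolding filterlim_at using tendsto_cnj[OF tendsto_ident_at, of 0 UNIV]
      by (auto simp: eventually_at_filter)
    then have "((\<lambda>h. E (cnj h)) \<longlongrightarrow> 0) (at 0)" by (rule filterlim_compose[OF taylor])
    then show "((\<lambda>h. ((f \<circ> cnj) h - (\<alpha> * (Re h)\<^sup>2 - \<beta> * (Im h)\<^sup>2)) / (norm h)\<^sup>2) \<longlongrightarrow> 0) (at 0)"
      by (simp add: E_def)
  qed
  show thesis
  proof (rule that[of r R "sqrt (\<alpha> / \<beta>)" k "\<lambda>x. - m x"])
    show "\<bar>y\<bar> \<le> R \<and> f (Complex x y) = 0 \<longleftrightarrow> y = k x \<or> y = - m x" if "\<bar>x\<bar> \<le> r" for x y
    proof -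
      have "y = - m x \<longleftrightarrow> \<bar>y\<bar> \<le> R \<and> f (Complex x y) = 0 \<and> 0 \<le> - (x * y)"
        using m(2)[OF that, of "- y"] by (auto simp: complex_cnj)
      then show ?thesis using k(2)[OF that, of y] by linarith
    qed
    show "x = 0" if "\<bar>x\<bar> \<le> r" "k x = - m x" for x
    proof (rule ccontr)
      assume "x \<noteq> 0"
      have "0 \<le> x * k x" "0 \<le> x * m x" "f (Complex x (k x)) = 0"
        using k(2)[OF that(1)] m(2)[OF that(1)] by blast+
      then have "k x = 0" using \<open>x \<noteq> 0\<close> that(2) by (auto simp: zero_le_mult_iff)
      then show False using hor[OF that(1) \<open>x \<noteq> 0\<close>] \<open>f (Complex x (k x)) = 0\<close> by simp
    qed
    show "((\<lambda>x. - m x) has_real_derivative - sqrt (\<alpha> / \<beta>)) (at 0)"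
      using md by (rule DERIV_minus)
  qed (use r R pos k(1) m(1) k0 m0 kd rectS in \<open>auto intro!: continuous_intros\<close>)
qed

lemma line_angle_pos:
  assumes "Im (v * cnj w) \<noteq> 0"
  shows "0 < line_angle v w"
proof -
  have nz: "norm v * norm w > 0" using assms by (auto simp: zero_less_mult_iff)
  have "(Re (v * cnj w))\<^sup>2 < (norm (v * cnj w))\<^sup>2"
    unfolding cmod_power2 using assms by simp
  then have "\<bar>Re (v * cnj w)\<bar> < norm (v * cnj w)"
    using power2_less_imp_less[of "\<bar>Re (v * cnj w)\<bar>"] by simp
  moreover have "v \<bullet> w = Re (v * cnj w)" by (simp add: inner_complex_def)
  ultimately have "\<bar>v \<bullet> w\<bar> / (norm v * norm w) < 1"
    using nz by (simp add: norm_mult divide_less_eq)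
  moreover have "- 1 < \<bar>v \<bullet> w\<bar> / (norm v * norm w)"
    using nz by (smt (verit) divide_nonneg_pos abs_ge_zero)
  ultimately show ?thesis unfolding line_angle_def by (intro conjunct1[OF arccos_lt_bounded]) auto
qed

text \<open>The map \<open>T w = z0 + \<omega> w\<close> with \<open>\<omega>\<^sup>2 (p1 z0) > 0\<close> reduces the general saddle to the normal form, since
  in the new coordinate the second derivatives are \<open>\<omega>\<^sup>2 p1\<close> and, because of \<open>\<omega> (cnj \<omega>) = 1\<close>, the
  unchanged \<open>p2\<close>. The neighbourhood is the image of the closed rectangle, so the level set in it is
  exactly the union of the two graphs with their end points.\<close>

lemma saddle_level_set_two_arcs:
  fixes f :: "complex \<Rightarrow> real" and p p1 :: "complex \<Rightarrow> complex" and p2 :: "complex \<Rightarrow> real"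
  assumes S: "open S" "z0 \<in> S"
    and df: "\<And>z. z \<in> S \<Longrightarrow> (f has_derivative (\<lambda>h. 2 * Re (p z * h))) (at z)"
    and dp: "\<And>z. z \<in> S \<Longrightarrow> (p has_derivative (\<lambda>h. p1 z * h + of_real (p2 z) * cnj h)) (at z)"
    and c1: "isCont p1 z0" and c2: "isCont p2 z0"
    and p0: "p z0 = 0" and saddle: "\<bar>p2 z0\<bar> < norm (p1 z0)"
  obtains U g h \<theta> where "U \<subseteq> S" "z0 \<in> interior U" "arc g" "arc h"
    and "{z \<in> U. f z = f z0} = path_image g \<union> path_image h"
    and "path_image g \<inter> path_image h = {z0}" "cross_at_angle g h z0 \<theta>" "0 < \<theta>"
proof -
  obtain \<omega> where \<omega>: "norm \<omega> = 1" "\<omega>\<^sup>2 * p1 z0 = of_real (norm (p1 z0))" by (rule rotation_exists)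
  have \<omega>c: "\<omega> * cnj \<omega> = 1" using \<omega>(1) by (simp add: complex_norm_square[symmetric])
  define T where "T w = z0 + \<omega> * w" for w
  have dT: "(T has_derivative (\<lambda>h. \<omega> * h)) (at w)" for w
    unfolding T_def by (auto intro!: derivative_eq_intros)
  have contT: "continuous_on X T" for X unfolding T_def by (intro continuous_intros)
  have T0: "T 0 = z0" by (simp add: T_def)
  have injT: "T v = T w \<longleftrightarrow> v = w" for v w using \<omega>(1) by (auto simp: T_def)
  have cT: "isCont (\<lambda>w. q (T w)) 0" if "isCont q z0" for q :: "complex \<Rightarrow> 'a::topological_space"
    by (rule isCont_o2[of 0 T q]) (use that contT[of UNIV] T0 in \<open>auto simp: continuous_on_eq_continuous_at\<close>)
  obtain r R k l c where pos: "0 < r" "0 < R" "0 < c"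
    and rect: "\<And>x y. \<bar>x\<bar> \<le> r \<Longrightarrow> \<bar>y\<bar> \<le> R \<Longrightarrow> Complex x y \<in> T -` S"
    and cont: "continuous_on {-r..r} k" "continuous_on {-r..r} l"
    and zero: "\<And>x y. \<bar>x\<bar> \<le> r \<Longrightarrow> \<bar>y\<bar> \<le> R \<and> f (T (Complex x y)) - f z0 = 0 \<longleftrightarrow> y = k x \<or> y = l x"
    and kl0: "k 0 = 0" "l 0 = 0" and kl: "\<And>x. \<bar>x\<bar> \<le> r \<Longrightarrow> k x = l x \<Longrightarrow> x = 0"
    and der: "(k has_real_derivative c) (at 0)" "(l has_real_derivative - c) (at 0)"
  proof (rule saddle_normal_form[of "T -` S" "\<lambda>w. f (T w) - f z0" "\<lambda>w. \<omega> * p (T w)"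
        "\<lambda>w. \<omega>\<^sup>2 * p1 (T w)" "\<lambda>w. p2 (T w)" "norm (p1 z0)"])
    show "open (T -` S)" using S(1) contT[of UNIV] by (rule open_vimage)
    fix w assume w: "w \<in> T -` S"
    then have Tw: "T w \<in> S" by simp
    show "((\<lambda>w. f (T w) - f z0) has_derivative (\<lambda>h. 2 * Re (\<omega> * p (T w) * h))) (at w)"
      using has_derivative_diff[OF has_derivative_compose[OF dT df[OF Tw]] has_derivative_const]
      by (simp add: mult_ac)
    show "((\<lambda>w. \<omega> * p (T w)) has_derivative (\<lambda>h. \<omega>\<^sup>2 * p1 (T w) * h + of_real (p2 (T w)) * cnj h)) (at w)"
      using has_derivative_mult_right[OF has_derivative_compose[OF dT dp[OF Tw]], of \<omega>]
    proof (rule has_derivative_eq_rhs)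
      have "\<omega> * (p1 (T w) * (\<omega> * h) + of_real (p2 (T w)) * cnj (\<omega> * h))
        = \<omega>\<^sup>2 * p1 (T w) * h + of_real (p2 (T w)) * cnj h * (\<omega> * cnj \<omega>)" for h
        by (simp add: algebra_simps power2_eq_square)
      then show "(\<lambda>h. \<omega> * (p1 (T w) * (\<omega> * h) + of_real (p2 (T w)) * cnj (\<omega> * h)))
        = (\<lambda>h. \<omega>\<^sup>2 * p1 (T w) * h + of_real (p2 (T w)) * cnj h)" by (simp add: \<omega>c)
    qed
  next
    show "isCont (\<lambda>w. \<omega>\<^sup>2 * p1 (T w)) 0" by (intro continuous_intros cT[OF c1])
  qed (use S p0 saddle \<omega> T0 cT[OF c2] in auto)
  define Q where "Q = {w. \<bar>Re w\<bar> \<le> r \<and> \<bar>Im w\<bar> \<le> R}"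
  \<comment> \<open>Reparametrising \<open>[-r, r]\<close> by \<open>[0, 1]\<close> puts the crossing at the parameter \<open>1/2\<close>.\<close>
  define \<gamma> where "\<gamma> q s = T (Complex (r * (2 * s - 1)) (q (r * (2 * s - 1))))" for q :: "real \<Rightarrow> real" and s
  have par: "\<bar>r * (2 * s - 1)\<bar> \<le> r" if "s \<in> {0..1}" for s
  proof -
    have "\<bar>2 * s - 1\<bar> \<le> 1" using that by auto
    then show ?thesis using pos(1) by (simp add: abs_mult)
  qed
  have arc: "arc (\<gamma> q)" if "continuous_on {-r..r} q" for q
    unfolding arc_def path_def
  proof
    show "continuous_on {0..1} (\<gamma> q)" unfolding \<gamma>_def
      by (intro continuous_on_compose2[OF contT[of UNIV]] continuous_intros continuous_on_compose2[OF that])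
         (use par in \<open>auto simp: abs_le_iff\<close>, (fastforce dest: par)+)
    show "inj_on (\<gamma> q) {0..1}" using pos(1) by (auto simp: \<gamma>_def injT inj_on_def)
  qed
  have image: "path_image (\<gamma> q) = {T (Complex x (q x)) | x. \<bar>x\<bar> \<le> r}" for q
  proof -
    have "x \<in> (\<lambda>s. r * (2 * s - 1)) ` {0..1}" if "\<bar>x\<bar> \<le> r" for x
    proof (rule image_eqI)
      show "x = r * (2 * ((x / r + 1) / 2) - 1)" using pos(1) by (simp add: field_simps)
      show "(x / r + 1) / 2 \<in> {0..1}" using that pos(1) by (auto simp: field_simps)
    qed
    then have "(\<lambda>s. r * (2 * s - 1)) ` {0..1} = {x. \<bar>x\<bar> \<le> r}" using par by blast
    then show ?thesis unfolding path_image_def \<gamma>_def by (auto simp: image_iff set_eq_iff) metis+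
  qed
  have tangent: "(\<gamma> q has_vector_derivative \<omega> * (2 * r * Complex 1 s)) (at (1/2))"
    if "(q has_real_derivative s) (at 0)" for q s
  proof -
    have "((\<lambda>t. r * (2 * t - 1)) has_real_derivative 2 * r) (at (1/2))"
      by (auto intro!: derivative_eq_intros)
    moreover have "(q has_real_derivative s) (at (r * (2 * (1/2) - 1)))" using that by simp
    ultimately have q: "((\<lambda>t. q (r * (2 * t - 1))) has_real_derivative s * (2 * r)) (at (1/2))"
      by (rule DERIV_chain2[rotated])
    have "((\<lambda>t. z0 + \<omega> * (of_real (r * (2 * t - 1)) + \<i> * of_real (q (r * (2 * t - 1)))))
        has_vector_derivative \<omega> * (of_real (2 * r) + \<i> * of_real (s * (2 * r)))) (at (1/2))"
      using q by (auto intro!: derivative_eq_intros)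
    then show ?thesis unfolding \<gamma>_def T_def Complex_eq by (simp add: algebra_simps)
  qed
  show thesis
  proof (rule that[of "T ` Q" "\<gamma> k" "\<gamma> l" "line_angle (\<omega> * (2 * r * Complex 1 c)) (\<omega> * (2 * r * Complex 1 (- c)))"])
    show "T ` Q \<subseteq> S" using rect by (auto simp: Q_def) (metis complex.collapse vimageD)
    show "z0 \<in> interior (T ` Q)"
    proof (rule interiorI[of "ball z0 (min r R)"])
      show "ball z0 (min r R) \<subseteq> T ` Q"
      proof
        fix z assume "z \<in> ball z0 (min r R)"
        then have z: "norm (z - z0) < min r R" by (simp add: dist_norm norm_minus_commute)
        have "norm (cnj \<omega> * (z - z0)) < min r R" using z \<omega>(1) by (simp add: norm_mult)
        then have "cnj \<omega> * (z - z0) \<in> Q"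
          unfolding Q_def using abs_Re_le_cmod[of "cnj \<omega> * (z - z0)"] abs_Im_le_cmod[of "cnj \<omega> * (z - z0)"]
          by auto
        moreover have "z = T (cnj \<omega> * (z - z0))" using \<omega>c by (simp add: T_def flip: mult.assoc)
        ultimately show "z \<in> T ` Q" by blast
      qed
    qed (use pos in auto)
    show "{z \<in> T ` Q. f z = f z0} = path_image (\<gamma> k) \<union> path_image (\<gamma> l)"
    proof (rule set_eqI)
      fix z
      have "z \<in> {z \<in> T ` Q. f z = f z0} \<longleftrightarrow>
          (\<exists>x y. z = T (Complex x y) \<and> \<bar>x\<bar> \<le> r \<and> \<bar>y\<bar> \<le> R \<and> f (T (Complex x y)) - f z0 = 0)"
        by (auto simp: Q_def) (metis complex.collapse)
      also have "\<dots> \<longleftrightarrow> (\<exists>x y. z = T (Complex x y) \<and> \<bar>x\<bar> \<le> r \<and> (y = k x \<or> y = l x))"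
        using zero by blast
      also have "\<dots> \<longleftrightarrow> z \<in> path_image (\<gamma> k) \<union> path_image (\<gamma> l)"
        unfolding image by blast
      finally show "z \<in> {z \<in> T ` Q. f z = f z0} \<longleftrightarrow> z \<in> path_image (\<gamma> k) \<union> path_image (\<gamma> l)" .
    qed
    have "z0 = T (Complex 0 0)" by (simp add: T0 flip: zero_complex.code)
    then show "path_image (\<gamma> k) \<inter> path_image (\<gamma> l) = {z0}"
      unfolding image using kl kl0 pos(1) by (auto simp: injT) force+
    have at0: "\<gamma> k (1/2) = z0" "\<gamma> l (1/2) = z0"
      using kl0 \<open>z0 = T (Complex 0 0)\<close> by (simp_all add: \<gamma>_def)
    have nz: "\<omega> * (2 * r * Complex 1 s) \<noteq> 0" for s
      using \<omega>(1) pos(1) by (auto simp: Complex_eq_0)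
    show "cross_at_angle (\<gamma> k) (\<gamma> l) z0 (line_angle (\<omega> * (2 * r * Complex 1 c)) (\<omega> * (2 * r * Complex 1 (- c))))"
      unfolding cross_at_angle_def
      by (rule bexI[of _ "1/2"], rule bexI[of _ "1/2"], intro exI)
         (use tangent[OF der(1)] tangent[OF der(2)] at0 nz in blast, auto)
    have "\<omega> * (2 * r * Complex 1 c) * cnj (\<omega> * (2 * r * Complex 1 (- c)))
        = (\<omega> * cnj \<omega>) * (of_real (4 * r\<^sup>2) * (Complex 1 c * Complex 1 c))"
      by (simp add: complex_cnj power2_eq_square mult_ac)
    also have "\<dots> = of_real (4 * r\<^sup>2) * Complex (1 - c\<^sup>2) (2 * c)"
      unfolding \<omega>c by (simp add: complex_eq_iff power2_eq_square)
    finally show "0 < line_angle (\<omega> * (2 * r * Complex 1 c)) (\<omega> * (2 * r * Complex 1 (- c)))"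
      using pos by (intro line_angle_pos) simp
  qed (use arc cont in auto)
qed

section \<open>The Schwarz-Pick lemma\<close>

text \<open>The Schwarz lemma for \<open>\<phi>\<close> composed on both sides with the disk automorphisms that move \<open>0\<close> to \<open>z\<close> and
  \<open>\<phi> z\<close> to \<open>0\<close>.\<close>

lemma schwarz_pick:
  assumes holf: "\<phi> holomorphic_on ball 0 1" and im: "\<phi> ` ball 0 1 \<subseteq> ball 0 1" and z: "norm z < 1"
  shows "(1 - (norm z)\<^sup>2) * norm (deriv \<phi> z) \<le> 1 - (norm (\<phi> z))\<^sup>2"
proof -
  define w where "w = \<phi> z"
  have w: "norm w < 1" using im z unfolding w_def by (metis image_subset_iff mem_ball_0)
  define M where "M = (\<lambda>\<zeta>. (\<zeta> + z) / (1 + cnj z * \<zeta>))"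
  define N where "N = (\<lambda>\<zeta>. (\<zeta> - w) / (1 - cnj w * \<zeta>))"
  have Me: "M = Moebius_function 0 (-z)" and Ne: "N = Moebius_function 0 w"
    by (auto simp: M_def N_def Moebius_function_simple)
  define h where "h = N \<circ> (\<phi> \<circ> M)"
  have M0: "M 0 = z" and N0: "N w = 0" by (auto simp: M_def N_def)
  have z2: "(norm z)\<^sup>2 < 1" and w2: "(norm w)\<^sup>2 < 1" using z w by (auto simp: abs_square_less_1)
  have ncn: "cnj u * u = of_real ((norm u)\<^sup>2)" "u * cnj u = of_real ((norm u)\<^sup>2)" for u
    by (simp_all add: complex_norm_square mult.commute flip: of_real_power)
  have holh: "h holomorphic_on ball 0 1"
    unfolding h_def Me Ne
    by (intro holomorphic_on_compose_gen[where t = "ball 0 1"] holf Moebius_function_holomorphic)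
       (use z w im Moebius_function_norm_lt_1 in \<open>auto simp: image_subset_iff\<close>)
  have "norm (h \<zeta>) < 1" if "norm \<zeta> < 1" for \<zeta>
    using that z w im Moebius_function_norm_lt_1[of "-z" \<zeta> 0]
    by (auto simp: h_def Me Ne image_subset_iff intro!: Moebius_function_norm_lt_1)
  then have le: "norm (deriv h 0) \<le> 1"
    by (intro Schwarz_Lemma(2)[OF holh, of 0]) (auto simp: h_def M0 N0 w_def[symmetric])
  have dM: "(M has_field_derivative of_real (1 - (norm z)\<^sup>2)) (at 0)"
    unfolding M_def by (auto intro!: derivative_eq_intros simp: ncn)
  have d\<phi>: "(\<phi> has_field_derivative deriv \<phi> z) (at (M 0))"
    using holf z by (auto simp: M0 intro: holomorphic_derivI)
  have ne: "1 - cnj w * w \<noteq> 0" using w2 by (metis ncn(1) of_real_1 of_real_diff of_real_eq_0_iff less_irrefl eq_iff_diff_eq_0)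
  have dN: "(N has_field_derivative 1 / of_real (1 - (norm w)\<^sup>2)) (at (\<phi> (M 0)))"
    unfolding N_def M0 w_def[symmetric] using ne
    by (auto intro!: derivative_eq_intros simp: ncn power2_eq_square divide_simps)
  have "(h has_field_derivative 1 / of_real (1 - (norm w)\<^sup>2) * (deriv \<phi> z * of_real (1 - (norm z)\<^sup>2))) (at 0)"
    unfolding h_def
    by (intro DERIV_chain DERIV_chain[OF d\<phi> dM]) (use dN in simp)
  then have "deriv h 0 = 1 / of_real (1 - (norm w)\<^sup>2) * (deriv \<phi> z * of_real (1 - (norm z)\<^sup>2))"
    by (rule DERIV_imp_deriv)
  then have "norm (deriv h 0) = norm (deriv \<phi> z) * (1 - (norm z)\<^sup>2) / (1 - (norm w)\<^sup>2)"
    using z2 w2 by (simp add: norm_mult norm_divide del: of_real_diff of_real_power)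
  then show ?thesis
    using le w2 by (simp add: w_def divide_le_eq mult.commute)
qed

section \<open>The derivatives of the logarithm of the hyperbolic derivative\<close>

text \<open>The Wirtinger derivative of \<open>- ln (1 - \<bar>g\<bar>\<^sup>2)\<close> in \<open>z\<close>. Taking \<open>g\<close> to be the identity or \<open>\<phi>\<close> covers
  both terms of this kind in \<open>ln \<bar>D\<bar>\<close>.\<close>

definition poincare_grad :: "(complex \<Rightarrow> complex) \<Rightarrow> complex \<Rightarrow> complex" where
  "poincare_grad g z = cnj (g z) * deriv g z / of_real (1 - (norm (g z))\<^sup>2)"

text \<open>The first derivative \<open>u\<^sub>z\<close> of \<open>u = ln \<bar>D\<bar>\<close>; then \<open>log_grad_z\<close> and \<open>log_grad_zbar\<close> below are
  its derivatives in \<open>z\<close> and in \<open>cnj z\<close>.\<close>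

definition log_grad :: "(complex \<Rightarrow> complex) \<Rightarrow> complex \<Rightarrow> complex" where
  "log_grad \<phi> z = deriv (deriv \<phi>) z / deriv \<phi> z / 2 - poincare_grad (\<lambda>w. w) z + poincare_grad \<phi> z"

definition log_hyp :: "(complex \<Rightarrow> complex) \<Rightarrow> complex \<Rightarrow> real" where
  "log_hyp \<phi> z = ln (norm (hyperbolic_derivative \<phi> z))"

definition log_grad_z :: "(complex \<Rightarrow> complex) \<Rightarrow> complex \<Rightarrow> complex" where
  "log_grad_z \<phi> z = deriv (\<lambda>w. deriv (deriv \<phi>) w / deriv \<phi> w) z / 2
     - (cnj z / of_real (1 - (norm z)\<^sup>2))\<^sup>2
     + cnj (\<phi> z) * deriv (deriv \<phi>) z / of_real (1 - (norm (\<phi> z))\<^sup>2) + (poincare_grad \<phi> z)\<^sup>2"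

definition log_grad_zbar :: "(complex \<Rightarrow> complex) \<Rightarrow> complex \<Rightarrow> real" where
  "log_grad_zbar \<phi> z = (norm (deriv \<phi> z) / (1 - (norm (\<phi> z))\<^sup>2))\<^sup>2 - 1 / (1 - (norm z)\<^sup>2)\<^sup>2"

lemma has_derivative_ln_norm:
  fixes F :: "complex \<Rightarrow> complex"
  assumes "(F has_field_derivative F') (at z)" "F z \<noteq> 0"
  shows "((\<lambda>z. ln (norm (F z))) has_derivative (\<lambda>h. Re (F' / F z * h))) (at z)"
proof -
  have "(F has_derivative (\<lambda>h. F' * h)) (at z)" using assms(1) by (simp add: has_field_derivative_def)
  from has_derivative_ln[OF _ has_derivative_compose[OF this has_derivative_norm]]
  have "((\<lambda>z. ln (norm (F z))) has_derivative (\<lambda>h. ((F' * h) \<bullet> sgn (F z)) * inverse (norm (F z)))) (at z)"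
    using assms(2) by simp
  then show ?thesis
  proof (rule has_derivative_eq_rhs)
    have "(w \<bullet> sgn (F z)) * inverse (norm (F z)) = Re (w / F z)" for w
    proof -
      have "(w \<bullet> sgn (F z)) * inverse (norm (F z)) = (w \<bullet> F z) / (norm (F z))\<^sup>2"
        by (simp add: sgn_div_norm divide_inverse power2_eq_square)
      then show ?thesis by (simp add: Re_divide cmod_power2 inner_complex_def)
    qed
    from this[of "F' * _"] show "(\<lambda>h. ((F' * h) \<bullet> sgn (F z)) * inverse (norm (F z))) = (\<lambda>h. Re (F' / F z * h))"
      by simp
  qed
qed

lemma has_derivative_ln_one_minus_norm2:
  assumes g: "(g has_field_derivative deriv g z) (at z)" and "norm (g z) < 1"
  shows "((\<lambda>z. ln (1 - (norm (g z))\<^sup>2)) has_derivative (\<lambda>h. - 2 * Re (poincare_grad g z * h))) (at z)"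
proof -
  have pos: "0 < 1 - (norm (g z))\<^sup>2" using assms(2) by (simp add: abs_square_less_1)
  have "(g has_derivative (\<lambda>h. deriv g z * h)) (at z)" using g by (simp add: has_field_derivative_def)
  then have "((\<lambda>z. 1 - g z \<bullet> g z) has_derivative (\<lambda>h. - 2 * (g z \<bullet> (deriv g z * h)))) (at z)"
    by (auto intro!: derivative_eq_intros simp: inner_commute)
  then have "((\<lambda>z. 1 - (norm (g z))\<^sup>2) has_derivative (\<lambda>h. - 2 * (g z \<bullet> (deriv g z * h)))) (at z)"
    by (simp add: power2_norm_eq_inner)
  from has_derivative_ln[OF pos this]
  show ?thesis
  proof (rule has_derivative_eq_rhs)
    have "Re (poincare_grad g z * h) = (g z \<bullet> (deriv g z * h)) / (1 - (norm (g z))\<^sup>2)" for h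
    proof -
      have "poincare_grad g z * h = (cnj (g z) * (deriv g z * h)) / of_real (1 - (norm (g z))\<^sup>2)"
        by (simp add: poincare_grad_def)
      then show ?thesis by (simp only: Re_divide_of_real) (simp add: inner_complex_def)
    qed
    then show "(\<lambda>h. - 2 * (g z \<bullet> (deriv g z * h)) * inverse (1 - (norm (g z))\<^sup>2)) = (\<lambda>h. - 2 * Re (poincare_grad g z * h))"
      by (simp only: divide_inverse mult.assoc)
  qed
qed

text \<open>The coefficient of \<open>cnj h\<close> collapses because
  \<open>1 / (1 - \<bar>g\<bar>\<^sup>2) + \<bar>g\<bar>\<^sup>2 / (1 - \<bar>g\<bar>\<^sup>2)\<^sup>2 = 1 / (1 - \<bar>g\<bar>\<^sup>2)\<^sup>2\<close>.\<close>

lemma has_derivative_poincare_grad: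
  assumes g: "(g has_field_derivative deriv g z) (at z)"
    and g': "(deriv g has_field_derivative deriv (deriv g) z) (at z)" and "norm (g z) < 1"
  shows "(poincare_grad g has_derivative
    (\<lambda>h. (cnj (g z) * deriv (deriv g) z / of_real (1 - (norm (g z))\<^sup>2) + (poincare_grad g z)\<^sup>2) * h
       + of_real ((norm (deriv g z) / (1 - (norm (g z))\<^sup>2))\<^sup>2) * cnj h)) (at z)"
proof -
  define W where "W z = 1 - g z * cnj (g z)" for z
  have WN: "of_real (1 - (norm (g z))\<^sup>2) = W z" for z 
    by (simp only: W_def of_real_diff of_real_1 complex_norm_square)
  have "1 - (norm (g z))\<^sup>2 > 0" using assms(3) by (simp add: abs_square_less_1)
  then have W0: "W z \<noteq> 0" by (metis WN of_real_eq_0_iff less_irrefl)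
  have pg: "poincare_grad g = (\<lambda>z. cnj (g z) * deriv g z / W z)"
    unfolding poincare_grad_def WN ..
  have dg: "(g has_derivative (\<lambda>h. deriv g z * h)) (at z)" and dg': "(deriv g has_derivative (\<lambda>h. deriv (deriv g) z * h)) (at z)"
    using g g' by (simp_all add: has_field_derivative_def)
  have dW: "(W has_derivative (\<lambda>h. - (g z * cnj (deriv g z * h) + deriv g z * h * cnj (g z)))) (at z)"
  proof -
    have "(W has_derivative (\<lambda>h. 0 - (g z * cnj (deriv g z * h) + deriv g z * h * cnj (g z)))) (at z)"
      unfolding W_def[abs_def]
      by (intro has_derivative_diff has_derivative_const has_derivative_mult has_derivative_cnj dg)
    then show ?thesis by simp
  qed
  have sq: "of_real ((norm (deriv g z) / (1 - (norm (g z))\<^sup>2))\<^sup>2) = deriv g z * cnj (deriv g z) / (W z)\<^sup>2"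
  proof -
    have "of_real ((a / b)\<^sup>2) = of_real (a\<^sup>2) / (of_real b :: complex)\<^sup>2" for a b :: real
      by (simp add: power_divide)
    then show ?thesis by (simp only: WN complex_norm_square)
  qed
  have "((\<lambda>z. cnj (g z) * deriv g z / W z) has_derivative
    (\<lambda>h. - (cnj (g z) * deriv g z) * (inverse (W z) * - (g z * cnj (deriv g z * h) + deriv g z * h * cnj (g z)) * inverse (W z))
        + (cnj (g z) * (deriv (deriv g) z * h) + cnj (deriv g z * h) * deriv g z) / W z)) (at z)"
    by (intro has_derivative_divide has_derivative_mult dg' dW has_derivative_cnj dg W0)
  then show ?thesis unfolding pg sq WN
  proof (rule has_derivative_eq_rhs)
    have "- (cnj (g z) * deriv g z) * (inverse (W z) * - (g z * cnj (deriv g z * h) + deriv g z * h * cnj (g z)) * inverse (W z))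
        + (cnj (g z) * (deriv (deriv g) z * h) + cnj (deriv g z * h) * deriv g z) / W z
      = (cnj (g z) * deriv (deriv g) z / W z + (cnj (g z) * deriv g z / W z)\<^sup>2) * h
       + deriv g z * cnj (deriv g z) / (W z)\<^sup>2 * ((g z * cnj (g z) + W z) * cnj h)" for h
      using W0 by (simp add: divide_simps power2_eq_square) (simp add: algebra_simps)
    moreover have "g z * cnj (g z) + W z = 1" by (simp add: W_def)
    ultimately show "(\<lambda>h. - (cnj (g z) * deriv g z) * (inverse (W z) * - (g z * cnj (deriv g z * h) + deriv g z * h * cnj (g z)) * inverse (W z))
        + (cnj (g z) * (deriv (deriv g) z * h) + cnj (deriv g z * h) * deriv g z) / W z)
      = (\<lambda>h. (cnj (g z) * deriv (deriv g) z / W z + (cnj (g z) * deriv g z / W z)\<^sup>2) * h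
       + deriv g z * cnj (deriv g z) / (W z)\<^sup>2 * cnj h)" by (simp add: fun_eq_iff)
  qed
qed

lemma deriv_ident_fun: "deriv (\<lambda>w. w) = (\<lambda>z::complex. 1)"
  by auto

lemma poincare_grad_ident: "poincare_grad (\<lambda>w. w) z = cnj z / of_real (1 - (norm z)\<^sup>2)"
  by (simp add: poincare_grad_def)

locale disk_self_map =
  fixes \<phi> :: "complex \<Rightarrow> complex"
  assumes holomorphic: "\<phi> holomorphic_on ball 0 1"
    and self_map: "\<phi> ` ball 0 1 \<subseteq> ball 0 1"
begin

definition regular :: "complex set" where
  "regular = {z \<in> ball 0 1. deriv \<phi> z \<noteq> 0}"

lemma holomorphic_derivs: "deriv \<phi> holomorphic_on ball 0 1" "deriv (deriv \<phi>) holomorphic_on ball 0 1"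
  using holomorphic by (simp_all add: holomorphic_deriv)

lemma norm_less_1: "norm z < 1 \<Longrightarrow> norm (\<phi> z) < 1"
  using self_map by (metis image_subset_iff mem_ball_0)

lemma has_field_derivatives:
  assumes "norm z < 1"
  shows "(\<phi> has_field_derivative deriv \<phi> z) (at z)"
    and "(deriv \<phi> has_field_derivative deriv (deriv \<phi>) z) (at z)"
  using assms holomorphic holomorphic_derivs(1) by (auto intro: holomorphic_derivI[of _ "ball 0 1"])

lemma open_regular: "open regular"
proof -
  have "continuous_on (ball 0 1) (deriv \<phi>)"
    using holomorphic_derivs(1) by (rule holomorphic_on_imp_continuous_on)
  then have "open ({z \<in> ball 0 1. deriv \<phi> z \<in> - {0}})"
    by (intro continuous_open_preimage[unfolded vimage_def Int_def, simplified]) auto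
  then show ?thesis by (simp add: regular_def)
qed

lemma regularD: "z \<in> regular \<Longrightarrow> norm z < 1 \<and> deriv \<phi> z \<noteq> 0 \<and> norm (\<phi> z) < 1"
  using norm_less_1 by (auto simp: regular_def)

lemma norm_hyp_pos: "0 < norm (hyperbolic_derivative \<phi> z)" if "z \<in> regular"
proof -
  have "(norm z)\<^sup>2 < 1" "(norm (\<phi> z))\<^sup>2 < 1" using regularD[OF that] by (simp_all add: abs_square_less_1)
  then have "1 - (norm z)\<^sup>2 \<noteq> 0" "1 - (norm (\<phi> z))\<^sup>2 \<noteq> 0" by auto
  then show ?thesis using regularD[OF that] unfolding hyperbolic_derivative_def
    by (simp del: of_real_diff of_real_power)
qed

lemma norm_hyp: "norm (hyperbolic_derivative \<phi> z) = (1 - (norm z)\<^sup>2) * norm (deriv \<phi> z) / (1 - (norm (\<phi> z))\<^sup>2)"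
  if "norm z < 1"
proof -
  have "(norm z)\<^sup>2 < 1" "(norm (\<phi> z))\<^sup>2 < 1" using that norm_less_1 by (simp_all add: abs_square_less_1)
  then show ?thesis unfolding hyperbolic_derivative_def
    by (simp add: norm_mult norm_divide del: of_real_diff of_real_power)
qed

lemma has_derivative_log_hyp:
  assumes z: "z \<in> regular"
  shows "(log_hyp \<phi> has_derivative (\<lambda>h. 2 * Re (log_grad \<phi> z * h))) (at z)"
proof -
  note r = regularD[OF z]
  have "((\<lambda>z. ln (1 - (norm z)\<^sup>2) - ln (1 - (norm (\<phi> z))\<^sup>2) + ln (norm (deriv \<phi> z))) has_derivative
    (\<lambda>h. - 2 * Re (poincare_grad (\<lambda>w. w) z * h) - - 2 * Re (poincare_grad \<phi> z * h)
         + Re (deriv (deriv \<phi>) z / deriv \<phi> z * h))) (at z)"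
    using r by (intro has_derivative_add has_derivative_diff has_derivative_ln_norm
        has_derivative_ln_one_minus_norm2[of "\<lambda>w. w"] has_derivative_ln_one_minus_norm2 has_field_derivatives)
      (auto intro!: derivative_eq_intros)
  then have "((\<lambda>z. ln (1 - (norm z)\<^sup>2) - ln (1 - (norm (\<phi> z))\<^sup>2) + ln (norm (deriv \<phi> z))) has_derivative
    (\<lambda>h. 2 * Re (log_grad \<phi> z * h))) (at z)"
  proof (rule has_derivative_eq_rhs)
    have "Re (c * h) = 2 * Re (c / 2 * h)" for c h :: complex by simp
    then have "Re (deriv (deriv \<phi>) z / deriv \<phi> z * h) = 2 * Re (deriv (deriv \<phi>) z / deriv \<phi> z / 2 * h)" for h .
    moreover have "log_grad \<phi> z * h = deriv (deriv \<phi>) z / deriv \<phi> z / 2 * h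
        - poincare_grad (\<lambda>w. w) z * h + poincare_grad \<phi> z * h" for h
      by (simp add: log_grad_def algebra_simps)
    ultimately show "(\<lambda>h. - 2 * Re (poincare_grad (\<lambda>w. w) z * h) - - 2 * Re (poincare_grad \<phi> z * h)
         + Re (deriv (deriv \<phi>) z / deriv \<phi> z * h)) = (\<lambda>h. 2 * Re (log_grad \<phi> z * h))"
      by (simp only: fun_eq_iff minus_complex.sel plus_complex.sel) simp
  qed
  then show ?thesis
  proof (rule has_derivative_transform_within_open[OF _ open_regular z])
    fix w assume w: "w \<in> regular"
    have "(norm w)\<^sup>2 < 1" "(norm (\<phi> w))\<^sup>2 < 1" using regularD[OF w] by (simp_all add: abs_square_less_1)
    then show "ln (1 - (norm w)\<^sup>2) - ln (1 - (norm (\<phi> w))\<^sup>2) + ln (norm (deriv \<phi> w)) = log_hyp \<phi> w"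
      using regularD[OF w] by (simp add: log_hyp_def norm_hyp ln_div ln_mult)
  qed
qed

lemma holomorphic_pre_schwarzian: "(\<lambda>w. deriv (deriv \<phi>) w / deriv \<phi> w) holomorphic_on regular"
proof -
  have "regular \<subseteq> ball 0 1" by (auto simp: regular_def)
  then show ?thesis
    by (intro holomorphic_on_divide holomorphic_derivs[THEN holomorphic_on_subset])
       (auto simp: regular_def)
qed

lemma has_derivative_log_grad:
  assumes z: "z \<in> regular"
  shows "(log_grad \<phi> has_derivative
    (\<lambda>h. log_grad_z \<phi> z * h + of_real (log_grad_zbar \<phi> z) * cnj h)) (at z)"
proof -
  note r = regularD[OF z]
  let ?\<beta> = "\<lambda>w. deriv (deriv \<phi>) w / deriv \<phi> w"
  have "(?\<beta> has_derivative (\<lambda>h. deriv ?\<beta> z * h)) (at z)"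
    using holomorphic_derivI[OF holomorphic_pre_schwarzian open_regular z]
    by (simp add: has_field_derivative_def)
  then have \<beta>: "((\<lambda>w. ?\<beta> w / 2) has_derivative (\<lambda>h. deriv ?\<beta> z * h / 2)) (at z)"
    by (rule bounded_linear.has_derivative[OF bounded_linear_divide])
  have i: "(poincare_grad (\<lambda>w. w) has_derivative
      (\<lambda>h. (cnj z / of_real (1 - (norm z)\<^sup>2))\<^sup>2 * h + of_real (1 / (1 - (norm z)\<^sup>2)\<^sup>2) * cnj h)) (at z)"
    using has_derivative_poincare_grad[of "\<lambda>w. w" z] r
    by (simp add: deriv_ident_fun poincare_grad_ident power_one_over del: of_real_diff of_real_power of_real_divide)
  note sum = has_derivative_add[OF has_derivative_diff[OF \<beta> i] has_derivative_poincare_grad[OF has_field_derivatives[OF conjunct1[OF r]]]]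
  have "X * h / 2 - (I * h + of_real j * k) + ((C + P) * h + of_real e * k)
      = (X / 2 - I + C + P) * h + of_real (e - j) * k" for X I C P h k :: complex and e j :: real
    by (simp add: algebra_simps)
  then show ?thesis unfolding log_grad_def[abs_def] log_grad_z_def log_grad_zbar_def
    by (intro has_derivative_eq_rhs[OF sum]) (use r in \<open>simp_all only: fun_eq_iff simp_thms\<close>)
qed

lemma isCont_log_grad_z: "isCont (log_grad_z \<phi>) z" and isCont_log_grad_zbar: "isCont (log_grad_zbar \<phi>) z"
  if z: "z \<in> regular"
proof -
  have r: "norm z < 1" "z \<in> ball 0 1" using regularD[OF z] by auto
  have ne: "1 - (norm z)\<^sup>2 \<noteq> 0" "1 - (norm (\<phi> z))\<^sup>2 \<noteq> 0"
    using regularD[OF z] abs_square_less_1[of "norm z"] abs_square_less_1[of "norm (\<phi> z)"] by auto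
  have c: "isCont q z" if "q holomorphic_on S" "open S" "z \<in> S" for q S
    using that by (meson continuous_on_eq_continuous_at holomorphic_on_imp_continuous_on)
  note cs = c[OF holomorphic open_ball r(2)] c[OF holomorphic_derivs(1) open_ball r(2)]
    c[OF holomorphic_derivs(2) open_ball r(2)]
    c[OF holomorphic_deriv[OF holomorphic_pre_schwarzian open_regular] open_regular z]
  show "isCont (log_grad_z \<phi>) z"
    unfolding log_grad_z_def[abs_def] poincare_grad_def
    using ne by (intro continuous_intros cs) (auto simp del: of_real_diff of_real_power)
  show "isCont (log_grad_zbar \<phi>) z"
    unfolding log_grad_zbar_def[abs_def] using ne by (intro continuous_intros cs) auto
qed

lemma critical_iff: "z \<in> critical_points \<phi> \<longleftrightarrow> log_grad \<phi> z = 0" if z: "z \<in> regular"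
proof -
  have "1 - (norm z)\<^sup>2 \<noteq> 0" using regularD[OF z] abs_square_less_1[of "norm z"] by auto
  then have "complex_of_real (1 - (norm z)\<^sup>2) \<noteq> 0" by (simp only: of_real_eq_0_iff not_False_eq_True)
  moreover from this have "A_function \<phi> z = Some (of_real (1 - (norm z)\<^sup>2) * log_grad \<phi> z)"
    using regularD[OF z] unfolding A_function_def log_grad_def poincare_grad_ident poincare_grad_def
    by (simp add: algebra_simps del: of_real_diff of_real_power)
  ultimately show ?thesis
    using z by (simp add: critical_points_def regular_def del: of_real_diff of_real_power)
qed

text \<open>Write \<open>b = \<phi>'' / (2 \<phi>')\<close>, and \<open>c\<close> for the gradient term of \<open>\<phi>\<close>. At a critical point the gradient
  term of the identity is \<open>b + c\<close>, and the quadratic part \<open>- (b + c)\<^sup>2 + 2 b c + c\<^sup>2\<close> of \<open>u\<^sub>z\<^sub>z\<close> is just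
  \<open>- b\<^sup>2\<close>, as in half the Schwarzian.\<close>

lemma log_grad_z_critical:
  assumes "log_grad \<phi> z = 0" "z \<in> regular"
  shows "log_grad_z \<phi> z = schwarzian \<phi> z / 2"
proof -
  define b c where "b = deriv (deriv \<phi>) z / deriv \<phi> z / 2" and "c = poincare_grad \<phi> z"
  have a: "cnj z / of_real (1 - (norm z)\<^sup>2) = b + c"
    using assms(1) by (simp add: log_grad_def poincare_grad_ident b_def c_def algebra_simps)
  have "cnj (\<phi> z) * deriv (deriv \<phi>) z / of_real (1 - (norm (\<phi> z))\<^sup>2) = 2 * b * c"
    using regularD[OF assms(2)] by (simp add: b_def c_def poincare_grad_def del: of_real_diff of_real_power)
  then have "log_grad_z \<phi> z = deriv (\<lambda>w. deriv (deriv \<phi>) w / deriv \<phi> w) z / 2 - b\<^sup>2"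
    unfolding log_grad_z_def a c_def[symmetric] by (simp add: power2_eq_square algebra_simps)
  then show ?thesis
    by (simp add: schwarzian_def b_def power_divide)
qed

lemma log_grad_zbar_eq:
  assumes "norm z < 1"
  shows "log_grad_zbar \<phi> z = - (1 - (norm (hyperbolic_derivative \<phi> z))\<^sup>2) / (1 - (norm z)\<^sup>2)\<^sup>2"
proof -
  have "1 - (norm z)\<^sup>2 \<noteq> 0" using assms abs_square_less_1[of "norm z"] by auto
  then show ?thesis
    unfolding norm_hyp[OF assms] log_grad_zbar_def
    by (simp add: power_divide power_mult_distrib diff_divide_distrib)
qed

lemma norm_hyp_le_1: "norm (hyperbolic_derivative \<phi> z) \<le> 1" if "norm z < 1"
  using schwarz_pick[OF holomorphic self_map that] norm_less_1[OF that] abs_square_less_1[of "norm (\<phi> z)"]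
  by (simp add: norm_hyp[OF that] divide_le_eq)

end

section \<open>Maxima, saddles and the Schwarzian\<close>

theorem theorem3p3:
  fixes \<phi> :: "complex \<Rightarrow> complex" and z0 :: complex
  assumes "\<phi> holomorphic_on ball 0 1"
    and "\<phi> ` ball 0 1 \<subseteq> ball 0 1"
    and "\<not> \<phi> constant_on ball 0 1"
    and "z0 \<in> critical_points \<phi>"
    and "deriv \<phi> z0 \<noteq> 0"
  shows
    "(local_max_at (\<lambda>z. norm (hyperbolic_derivative \<phi> z)) z0 \<longrightarrow>
        (1 - (norm z0)\<^sup>2)\<^sup>2 * norm (schwarzian \<phi> z0)
          \<le> 2 * (1 - (norm (hyperbolic_derivative \<phi> z0))\<^sup>2))
     \<and>
     ((1 - (norm z0)\<^sup>2)\<^sup>2 * norm (schwarzian \<phi> z0)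
          < 2 * (1 - (norm (hyperbolic_derivative \<phi> z0))\<^sup>2) \<longrightarrow>
        strict_local_max_at (\<lambda>z. norm (hyperbolic_derivative \<phi> z)) z0 \<and>
        z0 isolated_in critical_points \<phi>)
     \<and>
     ((1 - (norm z0)\<^sup>2)\<^sup>2 * norm (schwarzian \<phi> z0)
          > 2 * (1 - (norm (hyperbolic_derivative \<phi> z0))\<^sup>2) \<longrightarrow>
        z0 isolated_in critical_points \<phi> \<and>
        (\<exists>U0 g h \<theta>.
           z0 \<in> interior U0 \<and> arc g \<and> arc h \<and>
           U0 \<inter> level_curve \<phi> (norm (hyperbolic_derivative \<phi> z0))
             = path_image g \<union> path_image h \<and>
           path_image g \<inter> path_image h = {z0} \<and>
           cross_at_angle g h z0 \<theta> \<and> \<theta> > 0))"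
proof -
  interpret disk_self_map \<phi> using assms(1,2) by unfold_locales
  have z0: "z0 \<in> regular" using assms(4,5) by (simp add: regular_def critical_points_def)
  then have n0: "norm z0 < 1" by (simp add: regularD)
  define N where "N = (1 - (norm z0)\<^sup>2)\<^sup>2"
  have N: "N > 0" using n0 abs_square_less_1[of "norm z0"] by (simp add: N_def)
  let ?D = "\<lambda>z. norm (hyperbolic_derivative \<phi> z)"
  let ?f = "log_hyp \<phi>"
  define a b where "a = log_grad_z \<phi> z0" and "b = log_grad_zbar \<phi> z0"
  have p0: "log_grad \<phi> z0 = 0" using critical_iff[OF z0] assms(4) by simp
  have na: "norm (schwarzian \<phi> z0) = 2 * norm a"
    by (simp add: a_def log_grad_z_critical[OF p0 z0] norm_divide)
  have b: "1 - (?D z0)\<^sup>2 = - b * N" using N by (simp add: b_def log_grad_zbar_eq[OF n0] N_def)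
  have cmp: "N * norm (schwarzian \<phi> z0) \<le> 2 * (1 - (?D z0)\<^sup>2) \<longleftrightarrow> norm a + b \<le> 0"
    "N * norm (schwarzian \<phi> z0) < 2 * (1 - (?D z0)\<^sup>2) \<longleftrightarrow> norm a + b < 0"
    "N * norm (schwarzian \<phi> z0) > 2 * (1 - (?D z0)\<^sup>2) \<longleftrightarrow> norm a + b > 0"
  proof -
    have "N * norm (schwarzian \<phi> z0) - 2 * (1 - (?D z0)\<^sup>2) = 2 * N * (norm a + b)"
      unfolding na b by (simp add: algebra_simps)
    then show "N * norm (schwarzian \<phi> z0) \<le> 2 * (1 - (?D z0)\<^sup>2) \<longleftrightarrow> norm a + b \<le> 0"
      "N * norm (schwarzian \<phi> z0) < 2 * (1 - (?D z0)\<^sup>2) \<longleftrightarrow> norm a + b < 0"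
      "N * norm (schwarzian \<phi> z0) > 2 * (1 - (?D z0)\<^sup>2) \<longleftrightarrow> norm a + b > 0"
      using N by (smt (verit) zero_less_mult_iff mult_less_0_iff)+
  qed
  have b0: "b \<le> 0"
  proof -
    have "0 \<le> 1 - (?D z0)\<^sup>2" using norm_hyp_le_1[OF n0] by (simp add: power_le_one)
    then show ?thesis using N unfolding b by (simp add: mult_le_0_iff)
  qed
  have mono: "?D z \<le> ?D z0 \<longleftrightarrow> ?f z \<le> ?f z0" "?D z < ?D z0 \<longleftrightarrow> ?f z < ?f z0"
    "?D z = ?D z0 \<longleftrightarrow> ?f z = ?f z0" if "z \<in> regular" for z
    using norm_hyp_pos[OF that] norm_hyp_pos[OF z0] by (simp_all add: log_hyp_def)
  have reg: "\<forall>\<^sub>F z in nhds z0. z \<in> regular" using open_regular z0 by (rule eventually_nhds_in_open)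
  then have reg': "\<forall>\<^sub>F z in at z0. z \<in> regular" by (simp add: eventually_at_filter eventually_mono)
  have dp: "(log_grad \<phi> has_derivative (\<lambda>h. a * h + of_real b * cnj h)) (at z0)"
    unfolding a_def b_def by (rule has_derivative_log_grad[OF z0])
  have taylor: "second_order_expansion ?f z0 a b"
    by (rule second_order_expansion_at_critical_point[OF open_regular z0 has_derivative_log_hyp p0 dp])
  have isolated: "z0 isolated_in critical_points \<phi>" if "norm a + b \<noteq> 0"
  proof -
    have "norm a \<noteq> norm (of_real b :: complex)" using that b0 by simp
    from real_linear_derivative_isolated_zero[OF p0 dp this] reg'
    have "\<forall>\<^sub>F z in at z0. z \<notin> critical_points \<phi>"
      by eventually_elim (simp add: critical_iff)
    then have "\<not> z0 islimpt critical_points \<phi>"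
      by (simp add: islimpt_iff_eventually)
    then show ?thesis using assms(4) by (simp add: isolated_in_islimpt_iff)
  qed
  show ?thesis unfolding N_def[symmetric] cmp
  proof (intro conjI impI)
    assume "local_max_at ?D z0"
    then have "\<forall>\<^sub>F z in nhds z0. ?D z \<le> ?D z0" by (simp add: local_max_at_def)
    then have "\<forall>\<^sub>F z in nhds z0. ?f z \<le> ?f z0" using reg by eventually_elim (simp add: mono)
    then show "norm a + b \<le> 0" by (rule local_max_imp_nonpos[OF taylor])
  next
    assume neg: "norm a + b < 0"
    then show "z0 isolated_in critical_points \<phi>" using isolated by simp
    show "strict_local_max_at ?D z0"
      unfolding strict_local_max_at_def using strict_max_if_neg[OF taylor neg] reg'
      by eventually_elim (simp add: mono)
  next
    assume pos: "norm a + b > 0"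
    then show "z0 isolated_in critical_points \<phi>" using isolated by simp
    have saddle: "\<bar>log_grad_zbar \<phi> z0\<bar> < norm (log_grad_z \<phi> z0)"
      using pos b0 by (simp add: a_def b_def)
    obtain U g h \<theta> where U: "U \<subseteq> regular" "z0 \<in> interior U" "arc g" "arc h"
      "{z \<in> U. ?f z = ?f z0} = path_image g \<union> path_image h"
      "path_image g \<inter> path_image h = {z0}" "cross_at_angle g h z0 \<theta>" "0 < \<theta>"
      by (rule saddle_level_set_two_arcs[OF open_regular z0 has_derivative_log_hyp has_derivative_log_grad
          isCont_log_grad_z[OF z0] isCont_log_grad_zbar[OF z0] p0 saddle])
    have "U \<inter> level_curve \<phi> (?D z0) = {z \<in> U. ?f z = ?f z0}"
      using U(1) mono(3) by (auto simp: level_curve_def regular_def)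
    then show "\<exists>U0 g h \<theta>. z0 \<in> interior U0 \<and> arc g \<and> arc h \<and>
           U0 \<inter> level_curve \<phi> (?D z0) = path_image g \<union> path_image h \<and>
           path_image g \<inter> path_image h = {z0} \<and> cross_at_angle g h z0 \<theta> \<and> \<theta> > 0"
      using U(2-8) by (intro exI[of _ U] exI[of _ g] exI[of _ h] exI[of _ \<theta>]) auto
  qed
qed

end
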